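(* Let $X$ be a Hilbert space and let $T:X\rightrightarrows X$ be a proper set-valued mapping with norm-closed graph. Then the following are equivalent: (i) $T$ is maximal monotone on $X$; (ii) $T$ is hypomonotone on $X$ and for every $(u,v)\in\operatorname{gph}T$ one has $\langle z,w\rangle\ge0$ whenever $w\in X$ and $z\in D^*_MT(u,v)(w)$. Moreover, if $\operatorname{dom}T$ is convex, the equivalence remains true when the hypomonotonicity of $T$ on $X$ in (ii) is replaced by semilocal hypomonotonicity of $T$ on $X$.
   Context: $X$ is a real Hilbert space identified with its dual. For $T:X\rightrightarrows X$: $\operatorname{dom}T$, $\operatorname{gph}T$ as usual; proper means nonempty domain. Monotone: $\langle v_1-v_2,u_1-u_2\rangle\ge0$ on $\operatorname{gph}T$; maximal monotone: monotone with graph not properly contained in that of another monotone mapping. Hypomonotone on $X$: exists $r>0$ with $\langle v_1-v_2,u_1-u_2\rangle\ge -r\|u_1-u_2\|^2$ on $\operatorname{gph}T$. Semilocally hypomonotone on $X$: for each $\bar u\in\operatorname{dom}T$ there are a neighborhood $U$ of $\bar u$ and $r>0$ with the same inequality for all pairs in $\operatorname{gph}T\cap(U\times X)$. Regular normal cone: $\widehat N(\bar p;\Omega)=\{q:\limsup_{p\to\bar p,\,p\in\Omega}\langle q,p-\bar p\rangle/\|p-\bar p\|\le0\}$; regular coderivative $\widehat D^*T(u,v)(w)=\{z:(z,-w)\in\widehat N((u,v);\operatorname{gph}T)\}$. Mixed limiting coderivative: $z\in D^*_MT(\bar u,\bar v)(w)$ iff there exist sequences $(u_k,v_k)\in\operatorname{gph}T$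 with $(u_k,v_k)\to(\bar u,\bar v)$ in norm, $w_k\to w$ in norm, and $z_k\to z$ weakly, with $z_k\in\widehat D^*T(u_k,v_k)(w_k)$ for all $k$. *)

theory Defs
  imports "HOL-Analysis.Analysis"
begin

text \<open>A set-valued mapping T : X \<rightrightarrows> X is modelled as a function 'a \<Rightarrow> 'a set.
  The Hilbert space X is a type of class real_inner + complete_space; the product X \<times> X
  carries the product inner product (so its norm is the Euclidean product norm).\<close>

definition gph :: "('a \<Rightarrow> 'b set) \<Rightarrow> ('a \<times> 'b) set" where
  "gph T = {(u, v). v \<in> T u}"

definition dom_sv :: "('a \<Rightarrow> 'b set) \<Rightarrow> 'a set" where
  "dom_sv T = {u. T u \<noteq> {}}"

definition proper_sv :: "('a \<Rightarrow> 'b set) \<Rightarrow> bool" where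
  "proper_sv T \<longleftrightarrow> dom_sv T \<noteq> {}"

definition monotone_sv :: "('a::real_inner \<Rightarrow> 'a set) \<Rightarrow> bool" where
  "monotone_sv T \<longleftrightarrow>
     (\<forall>u1 v1 u2 v2. (u1, v1) \<in> gph T \<longrightarrow> (u2, v2) \<in> gph T \<longrightarrow>
        inner (v1 - v2) (u1 - u2) \<ge> 0)"

definition maximal_monotone_sv :: "('a::real_inner \<Rightarrow> 'a set) \<Rightarrow> bool" where
  "maximal_monotone_sv T \<longleftrightarrow> monotone_sv T \<and>
     (\<forall>S. monotone_sv S \<longrightarrow> gph T \<subseteq> gph S \<longrightarrow> gph S = gph T)"

definition hypomonotone_sv :: "('a::real_inner \<Rightarrow> 'a set) \<Rightarrow> bool" where
  "hypomonotone_sv T \<longleftrightarrow> (\<exists>r>0.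
     \<forall>u1 v1 u2 v2. (u1, v1) \<in> gph T \<longrightarrow> (u2, v2) \<in> gph T \<longrightarrow>
        inner (v1 - v2) (u1 - u2) \<ge> - r * (norm (u1 - u2))\<^sup>2)"

definition semilocally_hypomonotone_sv :: "('a::real_inner \<Rightarrow> 'a set) \<Rightarrow> bool" where
  "semilocally_hypomonotone_sv T \<longleftrightarrow> (\<forall>ub \<in> dom_sv T. \<exists>U r. open U \<and> ub \<in> U \<and> r > 0 \<and>
     (\<forall>u1 v1 u2 v2. (u1, v1) \<in> gph T \<longrightarrow> (u2, v2) \<in> gph T \<longrightarrow> u1 \<in> U \<longrightarrow> u2 \<in> U \<longrightarrow>
        inner (v1 - v2) (u1 - u2) \<ge> - r * (norm (u1 - u2))\<^sup>2))"

text \<open>Regular (Frechet) normal cone: limsup_{p \<rightarrow> pb, p \<in> \<Omega>} <q, p - pb>/\<parallel>p - pb\<parallel> \<le> 0,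
  written out in epsilon-delta form (p \<noteq> pb in the limsup).\<close>
definition regular_normal_cone :: "'a::real_inner \<Rightarrow> 'a set \<Rightarrow> 'a set" where
  "regular_normal_cone pb \<Omega> = {q. \<forall>\<epsilon>>0. \<exists>\<delta>>0. \<forall>p\<in>\<Omega>.
      0 < norm (p - pb) \<and> norm (p - pb) < \<delta> \<longrightarrow> inner q (p - pb) \<le> \<epsilon> * norm (p - pb)}"

definition regular_coderivative ::
  "('a::real_inner \<Rightarrow> 'a set) \<Rightarrow> 'a \<Rightarrow> 'a \<Rightarrow> 'a \<Rightarrow> 'a set" where
  "regular_coderivative T u v w = {z. (z, - w) \<in> regular_normal_cone (u, v) (gph T)}"

definition weakly_converges :: "(nat \<Rightarrow> 'a::real_inner) \<Rightarrow> 'a \<Rightarrow> bool" where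
  "weakly_converges zs z \<longleftrightarrow> (\<forall>y. (\<lambda>k. inner (zs k) y) \<longlonglongrightarrow> inner z y)"

definition mixed_coderivative ::
  "('a::real_inner \<Rightarrow> 'a set) \<Rightarrow> 'a \<Rightarrow> 'a \<Rightarrow> 'a \<Rightarrow> 'a set" where
  "mixed_coderivative T ub vb w = {z. \<exists>us vs ws zs.
      (\<forall>k. (us k, vs k) \<in> gph T) \<and> us \<longlonglongrightarrow> ub \<and> vs \<longlonglongrightarrow> vb \<and>
      ws \<longlonglongrightarrow> w \<and> weakly_converges zs z \<and>
      (\<forall>k. zs k \<in> regular_coderivative T (us k) (vs k) (ws k))}"

definition coderivative_positive :: "('a::real_inner \<Rightarrow> 'a set) \<Rightarrow> bool" where
  "coderivative_positive T \<longleftrightarrow> (\<forall>u v. (u, v) \<in> gph T \<longrightarrow>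
      (\<forall>w z. z \<in> mixed_coderivative T u v w \<longrightarrow> inner z w \<ge> 0))"

end

theory Submission
  imports Defs
begin

text \<open>
  If T is maximal monotone, I + T is onto (Minty), so the graph can be explored in every direction
  d: it contains (u + a, v + b) with a + b = t d and inner a b \<ge> 0. Inserting these points in the
  definition of a regular normal (z, -w) gives norm (z - w) \<le> norm (z + w), that is
  inner z w \<ge> 0; weakly convergent sequences are bounded, so this passes to the mixed coderivative.

  Conversely, at a minimizer over gph T of a function with gradient (g1, g2), positivity of the
  regular coderivative says inner g1 g2 \<le> 0; the Borwein-Preiss variational principle supplies
  such minimizers up to arbitrarily small perturbations. Fix (a, b) and (x, y) in gph T, put p = a - x and
  \<eta> = (v - b) + s (u - a), and penalize inner p (u - a) by a convex function of norm \<eta> of slope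
  at least L > norm p / s. The gradient is (p + s d, d) with norm d \<ge> L, which is
  impossible unless \<eta> = 0, i.e. (u, v) = (a, b). Comparing with (x, y) yields
  s norm (x - a) \<le> norm ((y - b) + s (x - a)), and s \<rightarrow> \<infinity> gives inner (y - b) (x - a) \<ge> 0.
  A penalty that is steep away from 0 keeps the argument inside a ball on which T is hypomonotone;
  convexity of the domain then chains local monotonicity along segments. Finally, minimizing
  norm (u + v - y) shows that I + T is onto, hence T is maximal.
\<close>

section \<open>A smooth variational principle\<close>

text \<open>Serves twice in the variational principle: for the near-minimizers and for the partial
  sums of the gradient series.\<close>

lemma geometric_steps_converge:
  fixes x :: "nat \<Rightarrow> 'a::complete_space"
  assumes step: "\<And>n. dist (x n) (x (Suc n)) \<le> C * (1/2) ^ Suc n"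
  obtains l where "x \<longlonglongrightarrow> l" "\<And>n k. dist (x n) (x k) \<le> C" "\<And>n. dist l (x n) \<le> C"
proof -
  have "0 \<le> C" using order_trans[OF zero_le_dist step[of 0]] by simp
  have dist_x: "dist (x n) (x k) \<le> C * (1/2) ^ n" if "n \<le> k" for n k
  proof -
    \<comment> \<open>Subtracting \<open>C * (1/2) ^ k\<close> makes the induction close: a further
      step costs exactly what this term loses.\<close>
    have "dist (x n) (x k) \<le> C * (1/2) ^ n - C * (1/2) ^ k"
      using that
    proof (induction k rule: dec_induct)
      case (step k)
      have "dist (x n) (x (Suc k)) \<le> dist (x n) (x k) + dist (x k) (x (Suc k))"
        by (rule dist_triangle)
      with step.IH assms[of k] show ?case by simp
    qed simp
    moreover have "0 \<le> C * (1/2) ^ k" using \<open>0 \<le> C\<close> by simp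
    ultimately show ?thesis by linarith
  qed
  have dist_le: "dist (x n) (x k) \<le> C" for n k
  proof -
    have "dist (x i) (x j) \<le> C" if "i \<le> j" for i j
      using dist_x[OF that] mult_left_mono[OF power_le_one[of "1/2::real" i] \<open>0 \<le> C\<close>] by simp
    then show ?thesis by (metis dist_commute nat_le_linear)
  qed
  have "Cauchy x"
  proof (rule metric_CauchyI)
    fix \<eta> :: real assume "0 < \<eta>"
    then obtain N where "(1/2::real) ^ N < \<eta> / (C + 1)"
      using real_arch_pow_inv[of "\<eta> / (C + 1)" "1/2"] \<open>0 \<le> C\<close> by auto
    then have N: "(C + 1) * (1/2::real) ^ N < \<eta>" using \<open>0 \<le> C\<close> by (simp add: field_simps)
    have "dist (x n) (x k) < \<eta>" if "N \<le> n" "n \<le> k" for n k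
    proof -
      have "C * (1/2) ^ n \<le> (C + 1) * (1/2::real) ^ N"
        using that \<open>0 \<le> C\<close> by (intro mult_mono power_decreasing) auto
      then show ?thesis using dist_x[OF that(2)] N by linarith
    qed
    then show "\<exists>M. \<forall>m\<ge>M. \<forall>n\<ge>M. dist (x m) (x n) < \<eta>"
      by (metis dist_commute nat_le_linear)
  qed
  then obtain l where l: "x \<longlonglongrightarrow> l" using Cauchy_convergent convergent_def by blast
  have "dist l (x n) \<le> C" for n
  proof (rule LIMSEQ_le_const2)
    show "(\<lambda>k. dist (x k) (x n)) \<longlonglongrightarrow> dist l (x n)" by (intro tendsto_intros l)
  qed (use dist_le in auto)
  with l dist_le show thesis by (rule that)
qed

text \<open>Borwein-Preiss in a Hilbert space: each stage penalizes the squared distance to a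
  near-minimizer of the previous stage. Moving the centre of a quadratic only adds affine terms, so
  all penalties together amount to a linear term and one quadratic centred at the limit.\<close>

lemma smooth_variational_principle:
  fixes f :: "'a::{real_inner, complete_space} \<Rightarrow> real"
  assumes "closed \<Omega>" "\<Omega> \<noteq> {}" "continuous_on \<Omega> f"
    and bdd: "\<And>x. x \<in> \<Omega> \<Longrightarrow> m \<le> f x" and "0 < \<epsilon>"
  obtains p q where "p \<in> \<Omega>" "norm q \<le> \<epsilon>"
    "\<And>x. x \<in> \<Omega> \<Longrightarrow> f p \<le> f x + inner q (x - p) + \<epsilon> * (norm (x - p))\<^sup>2"
    "\<And>x. x \<in> \<Omega> \<Longrightarrow> f p \<le> f x + \<epsilon>"
proof -
  \<comment> \<open>Total weight of all penalties. It is half of \<epsilon> because \<open>q\<close>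
    carries a factor 2 and the final estimate of values spends \<open>\<delta>\<close>
    twice.\<close>
  define \<delta> where "\<delta> = \<epsilon> / 2"
  define c where "c = (\<lambda>n::nat. \<delta> * (1/2) ^ Suc n)"
  \<comment> \<open>Tuned so that \<open>2 * e n\<close> is \<open>c n\<close> times the square of
    \<open>(1/2) ^ Suc n\<close>, the step length aimed at.\<close>
  define e where "e = (\<lambda>n::nat. c n * (1/4) ^ Suc n / 2)"
  define pick where "pick = (\<lambda>n g. SOME p. p \<in> \<Omega> \<and> (\<forall>x\<in>\<Omega>. g p \<le> g x + e n))"
  \<comment> \<open>The recursion runs over functions, since each near-minimizer is picked from the
    objective built so far.\<close>
  define G where "G = rec_nat f (\<lambda>n g x. g x + c n * (norm (x - pick n g))\<^sup>2)"
  define p where "p = (\<lambda>n. pick n (G n))"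
  have "\<delta> > 0" using \<open>0 < \<epsilon>\<close> by (simp add: \<delta>_def)
  then have cpos: "c n > 0" and epos: "e n > 0" for n by (simp_all add: c_def e_def)
  have G0: "G 0 = f" and GS: "G (Suc n) = (\<lambda>x. G n x + c n * (norm (x - p n))\<^sup>2)" for n
    by (simp_all add: G_def p_def)
  have G_sum: "G n x = f x + (\<Sum>i<n. c i * (norm (x - p i))\<^sup>2)" for n x
    by (induction n) (simp_all add: G0 GS)
  have G_mono: "G k x \<le> G n x" if "k \<le> n" for k n x
    using that
  proof (induction n rule: dec_induct)
    case (step n)
    have "0 \<le> c n * (norm (x - p n))\<^sup>2" using cpos[of n] by simp
    with step show ?case by (simp add: GS)
  qed simp
  have p_ex: "\<exists>p. p \<in> \<Omega> \<and> (\<forall>x\<in>\<Omega>. G n p \<le> G n x + e n)" for n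
  proof -
    have ne: "G n ` \<Omega> \<noteq> {}" using assms by auto
    have "m \<le> G n x" if "x \<in> \<Omega>" for x
      using bdd[OF that] G_mono[of 0 n x] by (simp add: G0)
    then have bb: "bdd_below (G n ` \<Omega>)" by (auto simp: bdd_below_def)
    have "\<exists>y\<in>G n ` \<Omega>. y < Inf (G n ` \<Omega>) + e n"
      using cInf_lessD[OF ne, of "Inf (G n ` \<Omega>) + e n"] epos[of n] by auto
    then obtain x where "x \<in> \<Omega>" "G n x < Inf (G n ` \<Omega>) + e n" by auto
    moreover have "Inf (G n ` \<Omega>) \<le> G n y" if "y \<in> \<Omega>" for y
      using bb that by (simp add: cInf_lower)
    ultimately show ?thesis by (intro exI[of _ x]) (auto intro: order_trans less_imp_le)
  qed
  have "p n \<in> \<Omega> \<and> (\<forall>x\<in>\<Omega>. G n (p n) \<le> G n x + e n)" for n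
    unfolding p_def pick_def by (rule someI_ex[OF p_ex])
  then have p_in: "p n \<in> \<Omega>" and p_min: "x \<in> \<Omega> \<Longrightarrow> G n (p n) \<le> G n x + e n" for n x by auto
  have step: "dist (p n) (p (Suc n)) \<le> (1/2) ^ Suc n" for n
  proof -
    \<comment> \<open>The penalty added at stage \<open>n\<close> vanishes at \<open>p n\<close>, so
      comparing \<open>p (Suc n)\<close> with \<open>p n\<close> bounds it by the two
      tolerances.\<close>
    have "G n (p (Suc n)) + c n * (norm (p (Suc n) - p n))\<^sup>2 \<le> G n (p n) + e (Suc n)"
      using p_min[OF p_in, of "Suc n" n] by (simp add: GS)
    moreover have "G n (p n) \<le> G n (p (Suc n)) + e n" by (rule p_min[OF p_in])
    moreover have "e (Suc n) \<le> e n" using \<open>\<delta> > 0\<close> by (simp add: e_def c_def field_simps)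
    moreover have "2 * e n = c n * (1/4) ^ Suc n" by (simp add: e_def)
    ultimately have "c n * (norm (p (Suc n) - p n))\<^sup>2 \<le> c n * (1/4) ^ Suc n" by linarith
    then have "(norm (p (Suc n) - p n))\<^sup>2 \<le> (1/4) ^ Suc n" using cpos[of n] by simp
    also have "(1/4::real) ^ Suc n = ((1/2) ^ Suc n)\<^sup>2"
    proof -
      have "(1/4::real) = (1/2)\<^sup>2" by (simp add: power2_eq_square)
      then show ?thesis by (simp only: power_mult[symmetric] mult.commute)
    qed
    finally have "norm (p (Suc n) - p n) \<le> (1/2) ^ Suc n"
      by (rule power2_le_imp_le) simp
    then show ?thesis by (simp add: dist_norm norm_minus_commute)
  qed
  obtain l where l: "p \<longlonglongrightarrow> l" and dist_le1: "\<And>n k. dist (p n) (p k) \<le> 1"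
    and dist_l: "\<And>n. dist l (p n) \<le> 1"
    using geometric_steps_converge[of p 1] step by auto
  have l_near: "norm (l - p n) \<le> 1" for n using dist_l[of n] by (simp add: dist_norm)
  have l_in: "l \<in> \<Omega>" using closed_sequentially[OF assms(1)] p_in l by blast
  have c_sums: "c sums \<delta>"
  proof -
    have "(\<lambda>n. \<delta> / 2 * (1/2) ^ n) sums (\<delta> / 2 * (1 / (1 - 1/2)))"
      by (intro sums_mult geometric_sums) simp
    then show ?thesis by (simp add: c_def field_simps)
  qed
  have q_norm: "norm (c i *\<^sub>R (l - p i)) \<le> c i" for i
    using mult_left_mono[OF l_near less_imp_le[OF cpos[of i]], of i] cpos[of i] by simp
  \<comment> \<open>Increments have norm at most \<open>c i\<close>, as every \<open>p i\<close>
    lies within 1 of \<open>l\<close>. The empty partial sum then bounds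
    \<open>norm h\<close>.\<close>
  obtain h where h: "(\<lambda>n. \<Sum>i<n. c i *\<^sub>R (l - p i)) \<longlonglongrightarrow> h"
    and "\<And>n. dist h (\<Sum>i<n. c i *\<^sub>R (l - p i)) \<le> \<delta>"
    by (rule geometric_steps_converge[of "\<lambda>n. \<Sum>i<n. c i *\<^sub>R (l - p i)" \<delta>])
      (use q_norm in \<open>auto simp: dist_norm c_def\<close>)
  from this(2)[of 0] have h_le: "norm h \<le> \<delta>" by simp
  have q_sums: "(\<lambda>i. c i *\<^sub>R (l - p i)) sums h" using h by (simp add: sums_def)
  define q where "q = 2 *\<^sub>R h"
  have q_le: "norm q \<le> \<epsilon>" using h_le by (simp add: q_def \<delta>_def)
  have summ: "summable (\<lambda>i. c i * (norm (x - p i))\<^sup>2)" for x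
  proof (rule summable_comparison_test'[of "\<lambda>i. c i * (norm (x - l) + 1)\<^sup>2" 0])
    show "summable (\<lambda>i. c i * (norm (x - l) + 1)\<^sup>2)"
      by (intro summable_mult2 sums_summable[OF c_sums])
    fix i
    have "norm (x - p i) \<le> norm (x - l) + 1"
      using norm_triangle_ineq[of "x - l" "l - p i"] l_near[of i] by simp
    then have "(norm (x - p i))\<^sup>2 \<le> (norm (x - l) + 1)\<^sup>2" by (simp add: power_mono)
    then show "norm (c i * (norm (x - p i))\<^sup>2) \<le> c i * (norm (x - l) + 1)\<^sup>2"
      using cpos[of i] by simp
  qed
  define S where "S = (\<lambda>x. \<Sum>i. c i * (norm (x - p i))\<^sup>2)"
  have S: "(\<lambda>i. c i * (norm (x - p i))\<^sup>2) sums S x" for x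
    unfolding S_def by (rule summable_sums[OF summ])
  have G_lim: "(\<lambda>n. G n x) \<longlonglongrightarrow> f x + S x" for x
    unfolding G_sum by (intro tendsto_intros) (use S[of x] in \<open>simp add: sums_def\<close>)
  have "e \<longlonglongrightarrow> 0"
  proof (rule tendsto_sandwich[of "\<lambda>_. 0" _ _ c])
    show "\<forall>\<^sub>F n in sequentially. e n \<le> c n"
    proof (intro always_eventually allI)
      fix n
      have "(1/4::real) ^ Suc n / 2 \<le> 1" using power_le_one[of "1/4::real" "Suc n"] by simp
      then show "e n \<le> c n" using mult_left_mono[of "(1/4) ^ Suc n / 2" 1 "c n"] cpos[of n]
        by (simp add: e_def)
    qed
    show "c \<longlonglongrightarrow> 0" by (rule summable_LIMSEQ_zero[OF sums_summable[OF c_sums]])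
    show "\<forall>\<^sub>F n in sequentially. 0 \<le> e n"
      by (intro always_eventually allI less_imp_le epos)
  qed simp
  have min_S: "f l + S l \<le> f x + S x" if "x \<in> \<Omega>" for x
  proof -
    \<comment> \<open>For \<open>k \<le> n\<close>,
      \<open>G k (p n) \<le> G n (p n) \<le> G n x + e n\<close>; the limit in \<open>n\<close>
      comes first, then the one in \<open>k\<close>.\<close>
    have "G k l \<le> f x + S x" for k
    proof (rule LIMSEQ_le)
      have "(\<lambda>n. f (p n)) \<longlonglongrightarrow> f l"
        using assms(3) l_in p_in l unfolding continuous_on_sequentially by (auto simp: o_def)
      then show "(\<lambda>n. G k (p n)) \<longlonglongrightarrow> G k l"
        unfolding G_sum by (intro tendsto_intros l)
      have "(\<lambda>n. G n x + e n) \<longlonglongrightarrow> f x + S x + 0" by (intro tendsto_add G_lim \<open>e \<longlonglongrightarrow> 0\<close>)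
      then show "(\<lambda>n. G n x + e n) \<longlonglongrightarrow> f x + S x" by simp
      show "\<exists>N. \<forall>n\<ge>N. G k (p n) \<le> G n x + e n"
        using G_mono p_min[OF that] by (meson order_trans)
    qed
    then show ?thesis using LIMSEQ_le_const2[OF G_lim[of l]] by blast
  qed
  show thesis
  proof (rule that[OF l_in q_le])
    fix x assume x: "x \<in> \<Omega>"
    \<comment> \<open>Expanding the squares about \<open>l\<close> is exact: the quadratic
      coefficients sum to \<open>\<delta>\<close>, the linear ones to \<open>q\<close>.\<close>
    have "(\<lambda>i. inner (2 *\<^sub>R (c i *\<^sub>R (l - p i))) (x - l) + c i * (norm (x - l))\<^sup>2) sums
        (inner q (x - l) + \<delta> * (norm (x - l))\<^sup>2)"
      unfolding q_def
      by (intro sums_add sums_mult2 c_sums bounded_linear.sums[OF bounded_linear_inner_left]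
          bounded_linear.sums[OF bounded_linear_scaleR_right] q_sums)
    moreover have "(\<lambda>i. c i * (norm (x - p i))\<^sup>2 - c i * (norm (l - p i))\<^sup>2) sums (S x - S l)"
      by (intro sums_diff S)
    moreover have "inner (2 *\<^sub>R (c i *\<^sub>R (l - p i))) (x - l) + c i * (norm (x - l))\<^sup>2
        = c i * (norm (x - p i))\<^sup>2 - c i * (norm (l - p i))\<^sup>2" for i
      by (simp add: power2_norm_eq_inner algebra_simps inner_commute)
    ultimately have "S x - S l = inner q (x - l) + \<delta> * (norm (x - l))\<^sup>2"
      using sums_unique2 by (metis (no_types, lifting) sums_cong)
    moreover have "\<delta> * (norm (x - l))\<^sup>2 \<le> \<epsilon> * (norm (x - l))\<^sup>2"
      using \<open>0 < \<epsilon>\<close> by (simp add: \<delta>_def mult_right_mono)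
    ultimately show "f l \<le> f x + inner q (x - l) + \<epsilon> * (norm (x - l))\<^sup>2"
      using min_S[OF x] by linarith
  next
    fix x assume x: "x \<in> \<Omega>"
    have "S (p 0) \<le> \<delta>"
    proof (rule sums_le[OF _ S c_sums])
      fix i
      have "(norm (p 0 - p i))\<^sup>2 \<le> 1"
        using dist_le1[of 0 i] by (simp add: dist_norm power_le_one)
      then show "c i * (norm (p 0 - p i))\<^sup>2 \<le> c i"
        using mult_left_mono[of _ 1 "c i"] cpos[of i] by fastforce
    qed
    moreover have "0 \<le> S l" by (rule sums_le[OF _ sums_zero S]) (simp add: less_imp_le[OF cpos])
    moreover have "f (p 0) \<le> f x + e 0" using p_min[OF x, of 0] by (simp add: G0)
    moreover have "e 0 \<le> \<delta>" using \<open>\<delta> > 0\<close> by (simp add: e_def c_def)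
    ultimately show "f l \<le> f x + \<epsilon>" using min_S[OF p_in[of 0]] by (simp add: \<delta>_def)
  qed
qed

section \<open>Weak convergence and regular normals\<close>

text \<open>Uniform boundedness by Baire category: the closed sets \<open>A n\<close>, where all
  functionals are bounded by \<open>n\<close>, cover the space, so one of them contains a
  ball.\<close>

lemma weakly_converges_imp_bounded:
  fixes zs :: "nat \<Rightarrow> 'a::{real_inner, complete_space}"
  assumes "weakly_converges zs z"
  obtains B where "\<And>k. norm (zs k) \<le> B"
proof -
  define A where "A = (\<lambda>n::nat. {y. \<forall>k. \<bar>inner (zs k) y\<bar> \<le> real n})"
  have closed_A: "closed (A n)" for n
  proof -
    have "A n = (\<Inter>k. {y. \<bar>inner (zs k) y\<bar> \<le> real n})" by (auto simp: A_def)
    then show ?thesis by (simp add: closed_INT closed_Collect_le continuous_intros)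
  qed
  have "y \<in> (\<Union>n. A n)" for y
  proof -
    have "(\<lambda>k. inner (zs k) y) \<longlonglongrightarrow> inner z y" using assms by (simp add: weakly_converges_def)
    then have "Bseq (\<lambda>k. inner (zs k) y)" by (rule convergent_imp_Bseq[OF convergentI])
    then obtain K where "\<And>k. \<bar>inner (zs k) y\<bar> \<le> K" by (auto simp: Bseq_def)
    moreover obtain n :: nat where "K \<le> real n" using real_arch_simple by blast
    ultimately show ?thesis by (auto simp: A_def intro: order_trans)
  qed
  then have UN_A: "(\<Union>n. A n) = UNIV" by blast
  have "\<exists>n. interior (A n) \<noteq> {}"
  proof (rule ccontr)
    assume "\<not> ?thesis"
    then have "Met_TC.mtopology interior_of \<Union>(range A) = {}"
      by (intro Met_TC.metric_Baire_category_alt)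
        (auto simp: closed_A mcomplete_iff_complete complete_UNIV interior_of_def interior_def)
    then show False by (simp add: UN_A)
  qed
  then obtain n x r where "r > 0" and ball: "ball x r \<subseteq> A n"
    by (metis ex_in_conv mem_interior)
  have "norm (zs k) \<le> 4 * real n / r" for k
  proof (cases "zs k = 0")
    case False
    \<comment> \<open>Moving from the centre by \<open>r / 2\<close> along \<open>zs k\<close>
      raises the inner product by \<open>r / 2 * norm (zs k)\<close>, while both values stay within
      \<open>n\<close>.\<close>
    define y where "y = x + (r / 2 / norm (zs k)) *\<^sub>R zs k"
    have "dist x y < r" using False \<open>r > 0\<close> by (simp add: y_def dist_norm)
    then have "\<bar>inner (zs k) y\<bar> \<le> n" "\<bar>inner (zs k) x\<bar> \<le> n"
      using ball \<open>r > 0\<close> by (auto simp: A_def subset_iff)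
    moreover have "inner (zs k) y = inner (zs k) x + r / 2 * norm (zs k)"
      using False by (simp add: y_def inner_add_right flip: power2_norm_eq_inner)
        (simp add: power2_eq_square)
    ultimately have "r / 2 * norm (zs k) \<le> 2 * real n" by linarith
    then show ?thesis using \<open>r > 0\<close> by (simp add: field_simps)
  qed (use \<open>r > 0\<close> in simp)
  then show thesis by (rule that)
qed

text \<open>Split \<open>ws k\<close> into \<open>w\<close> and \<open>ws k - w\<close>: boundedness
  of \<open>zs\<close> makes the second contribution vanish.\<close>

lemma weakly_converges_inner:
  fixes zs :: "nat \<Rightarrow> 'a::{real_inner, complete_space}"
  assumes "weakly_converges zs z" "ws \<longlonglongrightarrow> w"
  shows "(\<lambda>k. inner (zs k) (ws k)) \<longlonglongrightarrow> inner z w"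
proof -
  obtain B where B: "\<And>k. norm (zs k) \<le> B" using weakly_converges_imp_bounded[OF assms(1)] by blast
  have "(\<lambda>k. inner (zs k) (ws k - w)) \<longlonglongrightarrow> 0"
  proof (rule tendsto_norm_zero_cancel, rule tendsto_sandwich[of "\<lambda>_. 0"])
    show "\<forall>\<^sub>F k in sequentially. norm (inner (zs k) (ws k - w)) \<le> B * norm (ws k - w)"
      by (intro always_eventually allI order_trans[OF Cauchy_Schwarz_ineq2[folded real_norm_def]]
          mult_right_mono B norm_ge_zero)
    have "(\<lambda>k. B * norm (ws k - w)) \<longlonglongrightarrow> B * norm (w - w)" by (intro tendsto_intros assms)
    then show "(\<lambda>k. B * norm (ws k - w)) \<longlonglongrightarrow> 0" by simp
  qed auto
  moreover have "(\<lambda>k. inner (zs k) w) \<longlonglongrightarrow> inner z w"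
    using assms(1) by (simp add: weakly_converges_def)
  ultimately have "(\<lambda>k. inner (zs k) w + inner (zs k) (ws k - w)) \<longlonglongrightarrow> inner z w + 0"
    by (intro tendsto_add)
  then show ?thesis by (simp add: inner_diff_right)
qed

text \<open>A quadratic error is eventually below any linear one. \<open>K\<close> may have any
  sign, hence the radius with \<open>\<bar>K\<bar> + 1\<close>.\<close>

lemma regular_normal_coneI:
  assumes "\<delta> > 0"
    and "\<And>x. x \<in> \<Omega> \<Longrightarrow> norm (x - p) < \<delta> \<Longrightarrow> inner q (x - p) \<le> K * (norm (x - p))\<^sup>2"
  shows "q \<in> regular_normal_cone p \<Omega>"
  unfolding regular_normal_cone_def
proof (intro CollectI allI impI)
  fix \<epsilon> :: real assume "\<epsilon> > 0"
  define d where "d = min \<delta> (\<epsilon> / (\<bar>K\<bar> + 1))"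
  have "d > 0" using assms(1) \<open>\<epsilon> > 0\<close> by (simp add: d_def)
  moreover have "inner q (x - p) \<le> \<epsilon> * norm (x - p)" if "x \<in> \<Omega>" "norm (x - p) < d" for x
  proof -
    have "K * norm (x - p) \<le> (\<bar>K\<bar> + 1) * (\<epsilon> / (\<bar>K\<bar> + 1))"
      using that by (intro mult_mono) (auto simp: d_def)
    then have "K * norm (x - p) \<le> \<epsilon>" by simp
    then have "K * norm (x - p) * norm (x - p) \<le> \<epsilon> * norm (x - p)" by (rule mult_right_mono) simp
    with assms(2)[OF that(1)] that(2) show ?thesis by (simp add: d_def power2_eq_square mult.assoc)
  qed
  ultimately show "\<exists>\<delta>>0. \<forall>p'\<in>\<Omega>. 0 < norm (p' - p) \<and> norm (p' - p) < \<delta> \<longrightarrow>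
      inner q (p' - p) \<le> \<epsilon> * norm (p' - p)" by blast
qed

section \<open>Minty's theorem\<close>

text \<open>
  E is the epigraph of the Fitzpatrick function of G, which dominates the duality pairing by
  maximality. Adding half the squared norm makes it strongly convex, so it attains its minimum, and the
  optimality condition at the minimizer (x, v) says that (-v, -x) is monotonically related to G.
\<close>

lemma maximal_monotone_resolvent_zero:
  fixes G :: "('a::{real_inner, complete_space} \<times> 'a) set"
  assumes "G \<noteq> {}"
    and mono: "\<And>a b a' b'. (a, b) \<in> G \<Longrightarrow> (a', b') \<in> G \<Longrightarrow> 0 \<le> inner (a - a') (b - b')"
    and maxi: "\<And>x v. (\<And>a b. (a, b) \<in> G \<Longrightarrow> 0 \<le> inner (a - x) (b - v)) \<Longrightarrow> (x, v) \<in> G"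
  obtains x where "(x, - x) \<in> G"
proof -
  \<comment> \<open>For \<open>z = (x, v)\<close> the constraint reads
    \<open>inner x v - inner (a - x) (b - v) \<le> s\<close>; hence the swapped pair
    \<open>(b, a)\<close>.\<close>
  define E where "E = {(z, s). \<forall>a b. (a, b) \<in> G \<longrightarrow> inner z (b, a) - inner a b \<le> s}"
  define \<phi> where "\<phi> = (\<lambda>(z :: 'a \<times> 'a, s). s + (norm z)\<^sup>2 / 2 :: real)"
  have E_G: "((a, b), inner a b) \<in> E" if "(a, b) \<in> G" for a b
    using mono[OF that] by (auto simp: E_def inner_diff_left inner_diff_right inner_commute algebra_simps)
  have E_ge: "inner x v \<le> s" if "((x, v), s) \<in> E" for x v s
  proof (rule ccontr)
    assume "\<not> ?thesis"
    then have *: "s < inner x v" by simp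
    \<comment> \<open>The constraints make \<open>(x, v)\<close> monotonically related to
      \<open>G\<close>, hence a member; its own constraint then reads
      \<open>inner x v \<le> s\<close>.\<close>
    have "0 \<le> inner (a - x) (b - v)" if "(a, b) \<in> G" for a b
      using \<open>((x, v), s) \<in> E\<close> that * unfolding E_def
      by (fastforce simp: inner_diff_left inner_diff_right inner_commute algebra_simps)
    then have "(x, v) \<in> G" by (rule maxi)
    then show False using \<open>((x, v), s) \<in> E\<close> * unfolding E_def
      by (fastforce simp: inner_commute)
  qed
  have \<phi>_nonneg: "0 \<le> \<phi> e" if "e \<in> E" for e
  proof -
    obtain x v s where e: "e = ((x, v), s)" by (metis surj_pair)
    have "0 \<le> (norm (x + v))\<^sup>2" by simp
    also have "\<dots> = (norm (x, v))\<^sup>2 + 2 * inner x v"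
      by (simp add: power2_norm_eq_inner inner_add_left inner_add_right inner_commute)
    finally show ?thesis using E_ge[of x v s] that by (simp add: e \<phi>_def)
  qed
  have E_convex: "(1 - t) *\<^sub>R e + t *\<^sub>R e' \<in> E" if "e \<in> E" "e' \<in> E" "0 \<le> t" "t \<le> 1" for e e' t
  proof -
    obtain z s z' s' where e: "e = (z, s)" "e' = (z', s')" by (metis surj_pair)
    have "inner ((1 - t) *\<^sub>R z + t *\<^sub>R z') (b, a) - inner a b \<le> (1 - t) * s + t * s'"
      if "(a, b) \<in> G" for a b
    proof -
      have "(1 - t) * (inner z (b, a) - inner a b) + t * (inner z' (b, a) - inner a b)
          \<le> (1 - t) * s + t * s'"
        using \<open>e \<in> E\<close> \<open>e' \<in> E\<close> that \<open>0 \<le> t\<close> \<open>t \<le> 1\<close>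
        by (intro add_mono mult_left_mono) (auto simp: E_def e)
      then show ?thesis by (simp add: inner_add_left algebra_simps del: inner_Pair)
    qed
    then show ?thesis by (auto simp: E_def e)
  qed
  have "closed E"
  proof -
    have "E = (\<Inter>(a, b)\<in>G. {e. inner (fst e) (b, a) - inner a b \<le> snd e})"
      by (auto simp: E_def)
    also have "closed \<dots>"
      by (intro closed_INT ballI) (auto intro!: closed_Collect_le continuous_intros)
    finally show ?thesis .
  qed
  define m where "m = Inf (\<phi> ` E)"
  have "E \<noteq> {}" using \<open>G \<noteq> {}\<close> E_G by fastforce
  then have m_le: "m \<le> \<phi> e" if "e \<in> E" for e
    unfolding m_def using that \<phi>_nonneg by (intro cInf_lower bdd_belowI2[of E 0]) auto
  have "\<exists>e\<in>E. \<phi> e < m + inverse (real (Suc n))" for n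
    using cInf_lessD[of "\<phi> ` E" "m + inverse (real (Suc n))"] \<open>E \<noteq> {}\<close> by (auto simp: m_def)
  then obtain e where e: "\<And>n. e n \<in> E" "\<And>n. \<phi> (e n) < m + inverse (real (Suc n))" by metis
  \<comment> \<open>Parallelogram law: at the midpoint \<open>\<phi>\<close> lies below the average
    by an eighth of this squared distance, yet it is at least \<open>m\<close>.\<close>
  have mid: "(norm (fst d - fst d'))\<^sup>2 \<le> 4 * (\<phi> d - m + (\<phi> d' - m))" if "d \<in> E" "d' \<in> E" for d d'
  proof -
    have "m \<le> \<phi> ((1 - 1/2) *\<^sub>R d + (1/2) *\<^sub>R d')"
      by (rule m_le[OF E_convex[OF that]]) auto
    then show ?thesis
      by (simp add: \<phi>_def case_prod_beta power2_norm_eq_inner inner_add_left inner_add_right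
          inner_diff_left inner_diff_right inner_commute algebra_simps add_divide_distrib)
  qed
  have "Cauchy (\<lambda>n. fst (e n))"
  proof (rule metric_CauchyI)
    fix \<eta> :: real assume "0 < \<eta>"
    then have "0 < \<eta>\<^sup>2 / 8" by simp
    then obtain N where N: "inverse (real (Suc N)) < \<eta>\<^sup>2 / 8" using reals_Archimedean by blast
    have "dist (fst (e n)) (fst (e k)) < \<eta>" if "N \<le> n" "N \<le> k" for n k
    proof -
      have "inverse (real (Suc n)) \<le> inverse (real (Suc N))" "inverse (real (Suc k)) \<le> inverse (real (Suc N))"
        using that by (simp_all add: le_imp_inverse_le)
      then have "\<phi> (e n) - m < \<eta>\<^sup>2 / 8" "\<phi> (e k) - m < \<eta>\<^sup>2 / 8"
        using e(2)[of n] e(2)[of k] N by linarith+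
      then have "4 * (\<phi> (e n) - m + (\<phi> (e k) - m)) < \<eta>\<^sup>2" by simp
      then have "(norm (fst (e n) - fst (e k)))\<^sup>2 < \<eta>\<^sup>2"
        using mid[OF e(1) e(1), of n k] by (rule le_less_trans[rotated])
      then show ?thesis using \<open>0 < \<eta>\<close> by (simp add: dist_norm power_less_imp_less_base)
    qed
    then show "\<exists>M. \<forall>m\<ge>M. \<forall>n\<ge>M. dist (fst (e m)) (fst (e n)) < \<eta>" by blast
  qed
  then obtain z where z: "(\<lambda>n. fst (e n)) \<longlonglongrightarrow> z" using Cauchy_convergent convergent_def by blast
  have \<phi>_lim: "(\<lambda>n. \<phi> (e n)) \<longlonglongrightarrow> m"
  proof (rule tendsto_sandwich[of "\<lambda>_. m" _ _ "\<lambda>n. m + inverse (real (Suc n))"])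
    show "(\<lambda>n. m + inverse (real (Suc n))) \<longlonglongrightarrow> m"
      using tendsto_add[OF tendsto_const[of m] LIMSEQ_inverse_real_of_nat] by simp
    show "\<forall>\<^sub>F n in sequentially. m \<le> \<phi> (e n)"
      by (intro always_eventually allI m_le e)
    show "\<forall>\<^sub>F n in sequentially. \<phi> (e n) \<le> m + inverse (real (Suc n))"
      by (intro always_eventually allI less_imp_le e)
  qed simp
  \<comment> \<open>Strong convexity controls first components only; the second ones are recovered
    from the values of \<open>\<phi>\<close>.\<close>
  define s where "s = m - (norm z)\<^sup>2 / 2"
  have "(\<lambda>n. \<phi> (e n) - (norm (fst (e n)))\<^sup>2 / 2) \<longlonglongrightarrow> s"
    unfolding s_def by (intro tendsto_intros \<phi>_lim z) simp
  then have "(\<lambda>n. snd (e n)) \<longlonglongrightarrow> s" by (simp add: \<phi>_def case_prod_beta)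
  with z have "(\<lambda>n. (fst (e n), snd (e n))) \<longlonglongrightarrow> (z, s)" by (rule tendsto_Pair)
  then have zs: "(z, s) \<in> E" using closed_sequentially[OF \<open>closed E\<close>, of e "(z, s)"] e(1) by simp
  have opt: "s \<le> s' + inner z (z' - z)" if "(z', s') \<in> E" for z' s'
  proof -
    \<comment> \<open>On the segment toward \<open>(z', s')\<close> the increase of
      \<open>\<phi>\<close> is \<open>t * (D + t * Q)\<close>; dividing by \<open>t\<close> and
      letting it tend to 0 leaves the directional derivative \<open>D\<close>.\<close>
    define D where "D = s' - s + inner z (z' - z)"
    define Q where "Q = (norm (z' - z))\<^sup>2 / 2"
    have "0 \<le> D + t * Q" if "0 < t" "t \<le> 1" for t
    proof -
      have "m \<le> \<phi> ((1 - t) *\<^sub>R (z, s) + t *\<^sub>R (z', s'))"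
        using E_convex[OF zs \<open>(z', s') \<in> E\<close>, of t] that by (intro m_le) auto
      moreover have "m = s + (norm z)\<^sup>2 / 2" by (simp add: s_def)
      moreover have "(1 - t) *\<^sub>R z + t *\<^sub>R z' = z + t *\<^sub>R (z' - z)" by (simp add: algebra_simps)
      ultimately have "0 \<le> t * (D + t * Q)"
        by (simp add: \<phi>_def D_def Q_def power2_norm_eq_inner inner_add_left inner_add_right inner_commute)
          (simp add: algebra_simps inner_commute power2_eq_square add_divide_distrib diff_divide_distrib)
      then show ?thesis using \<open>0 < t\<close> by (simp add: zero_le_mult_iff)
    qed
    then have "\<forall>\<^sub>F t in at_right 0. 0 \<le> D + t * Q"
      by (intro eventually_at_rightI[of 0 1]) auto
    moreover have "((\<lambda>t. D + t * Q) \<longlongrightarrow> D + 0 * Q) (at_right 0)" by (intro tendsto_intros)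
    ultimately have "0 \<le> D" by (intro tendsto_lowerbound[of "\<lambda>t. D + t * Q" D "at_right 0"]) auto
    then show ?thesis by (simp add: D_def)
  qed
  obtain x v where zxv: "z = (x, v)" by (metis surj_pair)
  \<comment> \<open>Optimality against \<open>((a, b), inner a b)\<close>, together with
    \<open>inner x v \<le> s\<close>.\<close>
  have related: "(norm (x + v))\<^sup>2 \<le> inner (a + v) (b + x)" if "(a, b) \<in> G" for a b
    using opt[OF E_G[OF that]] E_ge[of x v s] zs
    by (simp add: zxv power2_norm_eq_inner algebra_simps inner_commute)
  have "(- v, - x) \<in> G"
  proof (rule maxi)
    fix a b assume "(a, b) \<in> G"
    then show "0 \<le> inner (a - - v) (b - - x)"
      using order_trans[OF zero_le_power2 related] by simp
  qed
  \<comment> \<open>At \<open>(- v, - x)\<close> itself the right-hand side of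
    \<open>related\<close> is 0, so \<open>v = - x\<close>.\<close>
  with related[OF this] show thesis by (intro that[of x]) (simp add: add_eq_0_iff)
qed

text \<open>Adding the related point keeps the graph monotone, so by maximality it was there
  already.\<close>

lemma maximal_monotone_related:
  assumes "maximal_monotone_sv T"
    and rel: "\<And>a b. (a, b) \<in> gph T \<Longrightarrow> 0 \<le> inner (b - v) (a - x)"
  shows "(x, v) \<in> gph T"
proof -
  define S where "S = (\<lambda>u. {v'. (u, v') \<in> insert (x, v) (gph T)})"
  have gS: "gph S = insert (x, v) (gph T)" by (auto simp: S_def gph_def)
  have "monotone_sv S"
    unfolding monotone_sv_def
  proof (intro allI impI)
    fix u1 v1 u2 v2 assume "(u1, v1) \<in> gph S" "(u2, v2) \<in> gph S"
    then consider "(u1, v1) = (x, v)" "(u2, v2) = (x, v)" | "(u1, v1) = (x, v)" "(u2, v2) \<in> gph T"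
      | "(u1, v1) \<in> gph T" "(u2, v2) = (x, v)" | "(u1, v1) \<in> gph T" "(u2, v2) \<in> gph T"
      unfolding gS by blast
    then show "0 \<le> inner (v1 - v2) (u1 - u2)"
    proof cases
      case 2
      then show ?thesis using rel[of u2 v2]
        by (metis Pair_inject inner_minus_left inner_minus_right minus_diff_eq minus_minus)
    next
      case 4
      then show ?thesis using assms(1) unfolding maximal_monotone_sv_def monotone_sv_def by blast
    qed (use rel in auto)
  qed
  then have "gph S = gph T" using assms(1) gS unfolding maximal_monotone_sv_def by blast
  then show ?thesis using gS by blast
qed

text \<open>Shifting all values by \<open>y\<close> reduces the equation to finding a point
  \<open>(x, - x)\<close>; the shift preserves monotonicity and maximality.\<close>

lemma maximal_monotone_resolvent:
  fixes T :: "'a::{real_inner, complete_space} \<Rightarrow> 'a set"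
  assumes T: "maximal_monotone_sv T" and "gph T \<noteq> {}"
  obtains u v where "(u, v) \<in> gph T" "u + v = y"
proof -
  define G where "G = {(a, b). (a, b + y) \<in> gph T}"
  obtain a b where "(a, b) \<in> gph T" using assms(2) by fastforce
  then have "(a, b - y) \<in> G" by (simp add: G_def)
  then have "G \<noteq> {}" by blast
  then obtain x where "(x, - x) \<in> G"
  proof (rule maximal_monotone_resolvent_zero)
    fix a b a' b' assume "(a, b) \<in> G" "(a', b') \<in> G"
    then have "0 \<le> inner ((b + y) - (b' + y)) (a - a')"
      using T unfolding maximal_monotone_sv_def monotone_sv_def G_def by blast
    then show "0 \<le> inner (a - a') (b - b')" by (simp add: inner_commute)
  next
    fix x v assume rel: "\<And>a b. (a, b) \<in> G \<Longrightarrow> 0 \<le> inner (a - x) (b - v)"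
    have "(x, v + y) \<in> gph T"
    proof (rule maximal_monotone_related[OF T])
      fix a b assume "(a, b) \<in> gph T"
      then show "0 \<le> inner (b - (v + y)) (a - x)"
        using rel[of a "b - y"] by (simp add: G_def inner_commute algebra_simps)
    qed
    then show "(x, v) \<in> G" by (simp add: G_def)
  qed
  then show thesis by (intro that[of x "- x + y"]) (auto simp: G_def)
qed

section \<open>Regular normals to a maximal monotone graph\<close>

lemma maximal_monotone_regular_coderivative:
  fixes T :: "'a::{real_inner, complete_space} \<Rightarrow> 'a set"
  assumes T: "maximal_monotone_sv T" and uv: "(u, v) \<in> gph T"
    and z: "z \<in> regular_coderivative T u v w"
  shows "0 \<le> inner z w"
proof -
  have approx: "inner (z - w) d \<le> norm (z + w) * norm d + \<epsilon>" if "0 < \<epsilon>" for d \<epsilon>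
  proof (cases "d = 0")
    case False
    \<comment> \<open>Error budget: the normal inequality is doubled below, so at displacement
      \<open>t * norm d\<close> it may cost only \<open>t * \<epsilon> / 2\<close>.\<close>
    define \<epsilon>' where "\<epsilon>' = \<epsilon> / (2 * norm d)"
    have "0 < \<epsilon>'" using that False by (simp add: \<epsilon>'_def)
    then obtain \<delta> where "\<delta> > 0" and \<delta>: "\<And>e. e \<in> gph T \<Longrightarrow> 0 < norm (e - (u, v)) \<Longrightarrow>
        norm (e - (u, v)) < \<delta> \<Longrightarrow> inner (z, - w) (e - (u, v)) \<le> \<epsilon>' * norm (e - (u, v))"
      using z unfolding regular_coderivative_def regular_normal_cone_def by blast
    \<comment> \<open>Displacements of norm at most \<open>t * norm d = \<delta> / 2\<close> stay
      where the normal inequality holds.\<close>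
    define t where "t = \<delta> / (2 * norm d)"
    have "t > 0" using \<open>\<delta> > 0\<close> False by (simp add: t_def)
    obtain u' v' where uv': "(u', v') \<in> gph T" "u' + v' = u + v + t *\<^sub>R d"
      using maximal_monotone_resolvent[OF T] uv by blast
    define a b where "a = u' - u" and "b = v' - v"
    have ab: "a + b = t *\<^sub>R d" using uv'(2) by (simp add: a_def b_def algebra_simps)
    have "0 \<le> inner a b"
      using T uv uv' unfolding maximal_monotone_sv_def monotone_sv_def a_def b_def
      by (metis inner_commute)
    \<comment> \<open>Since \<open>inner a b\<close> is nonnegative, the sum is at least as long as
      the pair and the difference; its length \<open>t * norm d\<close> is known.\<close>
    then have "(norm (a, b))\<^sup>2 \<le> (norm (a + b))\<^sup>2" "(norm (a - b))\<^sup>2 \<le> (norm (a + b))\<^sup>2"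
      by (simp_all add: power2_norm_eq_inner inner_add_left inner_add_right inner_diff_left
          inner_diff_right inner_commute)
    then have le: "norm (a, b) \<le> t * norm d" "norm (a - b) \<le> t * norm d"
      using \<open>t > 0\<close> by (simp_all add: ab power2_le_iff_abs_le)
    have "inner (z, - w) (a, b) \<le> \<epsilon>' * norm (a, b)"
    proof (cases "(a, b) = 0")
      case False
      have "norm (a, b) < \<delta>" using le(1) \<open>\<delta> > 0\<close> \<open>d \<noteq> 0\<close> by (simp add: t_def)
      then show ?thesis using \<delta>[OF uv'(1)] False by (simp add: a_def b_def)
    qed (simp add: zero_prod_def)
    also have "\<dots> \<le> \<epsilon>' * (t * norm d)" using le(1) \<open>0 < \<epsilon>'\<close> by simp
    also have "\<dots> = t * \<epsilon> / 2" using False by (simp add: \<epsilon>'_def)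
    finally have "2 * inner z a - 2 * inner w b \<le> t * \<epsilon>" by simp
    \<comment> \<open>This polarization isolates the prescribed direction \<open>a + b\<close>; the
      other term is left to Cauchy-Schwarz.\<close>
    moreover have "2 * inner z a - 2 * inner w b = inner (z + w) (a - b) + inner (z - w) (a + b)"
      by (simp add: algebra_simps)
    moreover have "- (norm (z + w) * (t * norm d)) \<le> inner (z + w) (a - b)"
      using Cauchy_Schwarz_ineq2[of "z + w" "a - b"] mult_left_mono[OF le(2) norm_ge_zero[of "z + w"]]
      by linarith
    ultimately have "t * inner (z - w) d \<le> t * (norm (z + w) * norm d + \<epsilon>)"
      by (simp add: ab algebra_simps)
    then show ?thesis using \<open>t > 0\<close> by simp
  qed (use that in simp)
  \<comment> \<open>The choice \<open>d = z - w\<close> turns the bound into a comparison of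
    norms.\<close>
  have "inner (z - w) (z - w) \<le> norm (z + w) * norm (z - w)"
    by (rule field_le_epsilon) (rule approx)
  then have "norm (z - w) \<le> norm (z + w)"
    by (cases "z = w") (auto simp flip: power2_norm_eq_inner simp: power2_eq_square)
  then have "(norm (z - w))\<^sup>2 \<le> (norm (z + w))\<^sup>2" by (rule power_mono) simp
  then show ?thesis
    by (simp add: power2_norm_eq_inner inner_add_left inner_add_right inner_diff_left
        inner_diff_right inner_commute)
qed

lemma maximal_monotone_imp_coderivative_positive:
  fixes T :: "'a::{real_inner, complete_space} \<Rightarrow> 'a set"
  assumes "maximal_monotone_sv T"
  shows "coderivative_positive T"
  unfolding coderivative_positive_def mixed_coderivative_def
proof clarify
  fix w z us vs ws zs
  assume *: "\<forall>k. (us k, vs k) \<in> gph T" "ws \<longlonglongrightarrow> w" "weakly_converges zs z"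
    "\<forall>k. zs k \<in> regular_coderivative T (us k) (vs k) (ws k)"
  have "(\<lambda>k. inner (zs k) (ws k)) \<longlonglongrightarrow> inner z w" by (rule weakly_converges_inner) fact+
  then show "0 \<le> inner z w"
    by (rule LIMSEQ_le_const) (use maximal_monotone_regular_coderivative[OF assms] * in blast)
qed

section \<open>From positive coderivatives to monotonicity\<close>

text \<open>Fermat's rule on the graph: minus the gradient of the perturbed function is a regular
  normal, so \<open>- (g1 + q1)\<close> lies in the coderivative at \<open>g2 + q2\<close>. The
  quadratic upper bound on \<open>f\<close> stands in for differentiability.\<close>

lemma approx_minimizer_gradient:
  assumes pos: "\<And>z w. z \<in> regular_coderivative T u v w \<Longrightarrow> 0 \<le> inner z w"
    and "\<delta> > 0"
    and minim: "\<And>x. x \<in> gph T \<Longrightarrow> norm (x - (u, v)) < \<delta> \<Longrightarrow>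
      f (u, v) \<le> f x + inner (q1, q2) (x - (u, v)) + \<epsilon> * (norm (x - (u, v)))\<^sup>2"
    and upper: "\<And>x. f x \<le> f (u, v) + inner (g1, g2) (x - (u, v)) + K * (norm (x - (u, v)))\<^sup>2"
  shows "inner (g1 + q1) (g2 + q2) \<le> (0::real)"
proof -
  have "(- (g1 + q1), - (g2 + q2)) \<in> regular_normal_cone (u, v) (gph T)"
  proof (rule regular_normal_coneI[OF \<open>\<delta> > 0\<close>, where K = "K + \<epsilon>"])
    fix x assume "x \<in> gph T" "norm (x - (u, v)) < \<delta>"
    from minim[OF this] upper[of x]
    show "inner (- (g1 + q1), - (g2 + q2)) (x - (u, v)) \<le> (K + \<epsilon>) * (norm (x - (u, v)))\<^sup>2"
      by (cases x) (simp add: algebra_simps)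
  qed
  then have "- (g1 + q1) \<in> regular_coderivative T u v (g2 + q2)"
    by (simp add: regular_coderivative_def)
  from pos[OF this] show ?thesis by (metis inner_minus_left neg_0_le_iff_le)
qed

section \<open>Quadratic upper bounds for the penalty\<close>

lemma norm_upper_estimate:
  fixes h k :: "'a::real_inner"
  assumes "h \<noteq> 0"
  shows "norm k \<le> norm h + inner h (k - h) / norm h + (norm (k - h))\<^sup>2 / (2 * norm h)"
proof -
  have "2 * norm h * norm k \<le> (norm h)\<^sup>2 + (norm k)\<^sup>2"
    using sum_squares_bound[of "norm h" "norm k"] by simp
  also have "\<dots> = 2 * (norm h)\<^sup>2 + 2 * inner h (k - h) + (norm (k - h))\<^sup>2"
    by (simp add: power2_norm_eq_inner algebra_simps inner_commute)
  finally have "norm k \<le> (2 * (norm h)\<^sup>2 + 2 * inner h (k - h) + (norm (k - h))\<^sup>2) / (2 * norm h)"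
    using assms by (simp add: pos_le_divide_eq mult_ac)
  then show ?thesis using assms by (simp add: add_divide_distrib power2_eq_square[of "norm h"])
qed

text \<open>By the chain rule the gradient points along \<open>h\<close>, and its length is the
  slope of \<open>\<theta>\<close> at \<open>norm h\<close>, hence at least \<open>L\<close>. The
  squared positive part is a soft wall beyond \<open>t0\<close>.\<close>

lemma penalty_upper_estimate:
  fixes h :: "'a::real_inner"
  assumes "h \<noteq> 0" "0 < L" "0 \<le> M"
    and \<theta>: "\<theta> = (\<lambda>t::real. L * t + M * (max 0 (t - t0))\<^sup>2)"
  obtains d K where "L \<le> norm d" "0 \<le> K"
    "\<And>k. \<theta> (norm k) \<le> \<theta> (norm h) + inner d (k - h) + K * (norm (k - h))\<^sup>2"
proof -
  define \<theta>' where "\<theta>' = L + 2 * M * max 0 (norm h - t0)"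
  have "L \<le> \<theta>'" using assms by (simp add: \<theta>'_def)
  have taylor: "\<theta> t \<le> \<theta> (norm h) + \<theta>' * (t - norm h) + M * (t - norm h)\<^sup>2" for t
  proof -
    have "(max 0 (t - t0))\<^sup>2 \<le> (max 0 (norm h - t0))\<^sup>2 + 2 * max 0 (norm h - t0) * (t - norm h)
        + (t - norm h)\<^sup>2" (is "?l \<le> ?r")
    proof -
      have "?r = (max 0 (norm h - t0) + (t - norm h))\<^sup>2" by (simp add: power2_sum)
      moreover have "?l \<le> (max 0 (norm h - t0) + (t - norm h))\<^sup>2"
      proof (cases "t \<le> t0")
        case False
        then show ?thesis by (intro power_mono) auto
      qed simp
      ultimately show ?thesis by simp
    qed
    from mult_left_mono[OF this \<open>0 \<le> M\<close>] show ?thesis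
      by (simp add: \<theta> \<theta>'_def algebra_simps)
  qed
  show thesis
  proof (rule that[of "(\<theta>' / norm h) *\<^sub>R h" "\<theta>' / (2 * norm h) + M"])
    show "L \<le> norm ((\<theta>' / norm h) *\<^sub>R h)" "0 \<le> \<theta>' / (2 * norm h) + M"
      using assms \<open>L \<le> \<theta>'\<close> by auto
    fix k
    have "\<bar>norm k - norm h\<bar> \<le> norm (k - h)" by (rule norm_triangle_ineq3)
    then have "(norm k - norm h)\<^sup>2 \<le> (norm (k - h))\<^sup>2" by (simp add: abs_le_square_iff[symmetric])
    then have "M * (norm k - norm h)\<^sup>2 \<le> M * (norm (k - h))\<^sup>2" using \<open>0 \<le> M\<close> by (rule mult_left_mono)
    moreover have "\<theta>' * (norm k - norm h) \<le>
        \<theta>' * (inner h (k - h) / norm h + (norm (k - h))\<^sup>2 / (2 * norm h))"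
      using norm_upper_estimate[OF \<open>h \<noteq> 0\<close>, of k] \<open>L \<le> \<theta>'\<close> \<open>0 < L\<close> by (intro mult_left_mono) auto
    ultimately show "\<theta> (norm k) \<le> \<theta> (norm h) + inner ((\<theta>' / norm h) *\<^sub>R h) (k - h)
        + (\<theta>' / (2 * norm h) + M) * (norm (k - h))\<^sup>2"
      using taylor[of "norm k"] by (simp add: distrib_left distrib_right)
  qed
qed

lemma norm_add_scaleR_le_Pair:
  assumes "0 \<le> s"
  shows "norm (y + s *\<^sub>R x) \<le> (1 + s) * norm (x, y)"
proof -
  have "norm y \<le> norm (x, y)" "norm x \<le> norm (x, y)"
    by (rule norm_snd_le, rule norm_fst_le)
  then have "norm y + s * norm x \<le> norm (x, y) + s * norm (x, y)"
    using assms by (intro add_mono mult_left_mono)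
  then show ?thesis using norm_triangle_ineq[of y "s *\<^sub>R x"] assms by (simp add: algebra_simps)
qed

section \<open>Penalized minimization and local monotonicity\<close>

text \<open>If the estimate failed, some slope \<open>L\<close> above \<open>norm p / s\<close>
  would leave the penalized function negative at \<open>(x, y)\<close>, while it is 0 at
  \<open>(a, b)\<close>. An almost minimizer \<open>P\<close> then has
  \<open>\<eta> P \<noteq> 0\<close>, where the steep gradient contradicts positivity.\<close>

lemma coderivative_expansive:
  fixes T :: "'a::{real_inner, complete_space} \<Rightarrow> 'a set"
  assumes "closed (gph T)"
    and pos: "\<And>u v w z. (u, v) \<in> gph T \<Longrightarrow> z \<in> regular_coderivative T u v w \<Longrightarrow> 0 \<le> inner z w"
    and ab: "(a, b) \<in> gph T" and "R > 0" "r > 0"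
    and hypo: "\<And>u v. (u, v) \<in> gph T \<Longrightarrow> norm (u - a) \<le> R \<Longrightarrow>
      - r * (norm (u - a))\<^sup>2 \<le> inner (v - b) (u - a)"
    and "r < s" and xy: "(x, y) \<in> gph T" and "norm (x - a) \<le> R"
    and near: "norm ((y - b) + s *\<^sub>R (x - a)) \<le> (s - r) * R / 2"
  shows "s * norm (x - a) \<le> norm ((y - b) + s *\<^sub>R (x - a))"
proof (rule ccontr)
  assume neg: "\<not> ?thesis"
  define p where "p = a - x"
  define N where "N = norm ((y - b) + s *\<^sub>R (x - a))"
  have "0 < s" using \<open>r > 0\<close> \<open>r < s\<close> by simp
  have np: "norm (x - a) = norm p" by (simp add: p_def norm_minus_commute)
  have N: "0 \<le> N" "N < s * norm p" using neg by (simp_all add: N_def np)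
  then have "0 < norm p" using \<open>0 < s\<close> by (smt (verit) zero_less_mult_pos)
  \<comment> \<open>Slack of the failed estimate at the critical slope \<open>norm p / s\<close>;
    \<open>L\<close> exceeds that slope by so little that \<open>L * N < (norm p)\<^sup>2\<close>
    persists.\<close>
  define gap where "gap = (norm p)\<^sup>2 - norm p * N / s"
  have "gap > 0"
    using mult_strict_left_mono[OF N(2) \<open>0 < norm p\<close>] \<open>0 < s\<close>
    by (simp add: gap_def field_simps power2_eq_square)
  define L where "L = norm p / s + gap / (2 * (N + 1))"
  have "0 < L" using \<open>gap > 0\<close> \<open>0 < s\<close> N by (simp add: L_def add_nonneg_pos)
  \<comment> \<open>Excess slope: a lower bound for \<open>s * norm d - norm p\<close> once
    \<open>L \<le> norm d\<close>.\<close>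
  define X where "X = s * L - norm p"
  have "X = s * (gap / (2 * (N + 1)))" using \<open>0 < s\<close> by (simp add: X_def L_def distrib_left)
  then have "X > 0" using \<open>gap > 0\<close> \<open>0 < s\<close> N by simp
  have "N * (gap / (2 * (N + 1))) < gap"
    using \<open>gap > 0\<close> N by (simp add: field_simps add_nonneg_pos)
  then have LN: "L * N < (norm p)\<^sup>2" by (simp add: L_def gap_def algebra_simps)
  \<comment> \<open>Gathers the coefficients of the \<open>\<epsilon>\<close>-errors in the final
    gradient estimate; \<open>\<epsilon>\<close> is then set below what either case of the
    contradiction tolerates.\<close>
  define Y where "Y = (1 + s) * L + norm p + 1"
  have "Y > 0" using \<open>0 < s\<close> \<open>0 < L\<close> by (simp add: Y_def add_nonneg_pos)
  define \<epsilon> where "\<epsilon> = min 1 (min (((norm p)\<^sup>2 - L * N) / 2) (X * L / (2 * Y)))"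
  have \<epsilon>: "0 < \<epsilon>" "\<epsilon> \<le> 1" "\<epsilon> < (norm p)\<^sup>2 - L * N" "\<epsilon> * Y < X * L"
  proof -
    show "0 < \<epsilon>" "\<epsilon> \<le> 1" using LN \<open>X > 0\<close> \<open>Y > 0\<close> \<open>0 < L\<close> by (simp_all add: \<epsilon>_def)
    have "\<epsilon> \<le> ((norm p)\<^sup>2 - L * N) / 2" "\<epsilon> \<le> X * L / (2 * Y)"
      unfolding \<epsilon>_def by (blast intro: min.coboundedI2 min.cobounded1 min.cobounded2)+
    moreover have "0 < X * L" using \<open>X > 0\<close> \<open>0 < L\<close> by simp
    ultimately show "\<epsilon> < (norm p)\<^sup>2 - L * N" "\<epsilon> * Y < X * L"
      using LN \<open>Y > 0\<close> by (auto simp: field_simps)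
  qed
  \<comment> \<open>By \<open>strong\<close> below, \<open>norm (\<eta> P) < 2 * t0\<close> keeps
    \<open>u\<close> strictly inside the ball; by \<open>near\<close>, the wall is inactive at
    \<open>(x, y)\<close>.\<close>
  define t0 where "t0 = (s - r) * R / 2"
  have "t0 > 0" using \<open>R > 0\<close> \<open>r < s\<close> by (simp add: t0_def)
  \<comment> \<open>From \<open>2 * t0\<close> on, the wall outweighs the lower bound
    \<open>- (norm p * R)\<close> of the linear term by 2.\<close>
  define M where "M = (norm p * R + 2) / t0\<^sup>2"
  have "0 \<le> M" using \<open>R > 0\<close> by (simp add: M_def)
  define \<theta> where "\<theta> = (\<lambda>t::real. L * t + M * (max 0 (t - t0))\<^sup>2)"
  define \<eta> where "\<eta> = (\<lambda>e::'a\<times>'a. (snd e - b) + s *\<^sub>R (fst e - a))"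
  define f where "f = (\<lambda>e. inner p (fst e - a) + \<theta> (norm (\<eta> e)))"
  define \<Omega> where "\<Omega> = gph T \<inter> {e. norm (fst e - a) \<le> R}"
  have \<theta>_nonneg: "0 \<le> \<theta> t" if "0 \<le> t" for t
    using that \<open>0 < L\<close> \<open>0 \<le> M\<close> by (simp add: \<theta>_def)
  have "closed \<Omega>"
    unfolding \<Omega>_def using assms(1) by (intro closed_Int closed_Collect_le continuous_intros)
  have ab_in: "(a, b) \<in> \<Omega>" and xy_in: "(x, y) \<in> \<Omega>"
    using ab xy \<open>R > 0\<close> \<open>norm (x - a) \<le> R\<close> by (auto simp: \<Omega>_def)
  have cont: "continuous_on \<Omega> f"
    unfolding f_def \<theta>_def \<eta>_def by (intro continuous_intros)
  have lower: "- (norm p * R) \<le> inner p (fst e - a)" if "e \<in> \<Omega>" for e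
  proof -
    have "norm p * norm (fst e - a) \<le> norm p * R"
      using that by (intro mult_left_mono) (auto simp: \<Omega>_def)
    then show ?thesis using Cauchy_Schwarz_ineq2[of p "fst e - a"] by linarith
  qed
  then have "- (norm p * R) \<le> f e" if "e \<in> \<Omega>" for e
    using that \<theta>_nonneg[of "norm (\<eta> e)"] by (fastforce simp: f_def)
  then obtain P q where P: "P \<in> \<Omega>" and q: "norm q \<le> \<epsilon>"
    and P_min: "\<And>e. e \<in> \<Omega> \<Longrightarrow> f P \<le> f e + inner q (e - P) + \<epsilon> * (norm (e - P))\<^sup>2"
    and P_le: "\<And>e. e \<in> \<Omega> \<Longrightarrow> f P \<le> f e + \<epsilon>"
    using smooth_variational_principle[OF \<open>closed \<Omega>\<close> _ cont _ \<open>0 < \<epsilon>\<close>] ab_in by blast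
  obtain u v where Puv: "P = (u, v)" by (cases P)
  obtain q1 q2 where qq: "q = (q1, q2)" by (cases q)
  have uv: "(u, v) \<in> gph T" "norm (u - a) \<le> R" using P by (auto simp: \<Omega>_def Puv)
  have strong: "(s - r) * norm (u - a) \<le> norm (\<eta> P)"
  proof (cases "u = a")
    case False
    have "(s - r) * (norm (u - a))\<^sup>2 \<le> inner (\<eta> P) (u - a)"
      using hypo[OF uv] by (simp add: \<eta>_def Puv inner_add_left power2_norm_eq_inner algebra_simps)
    also have "\<dots> \<le> norm (\<eta> P) * norm (u - a)" by (rule norm_cauchy_schwarz)
    finally show ?thesis using False by (simp add: power2_eq_square mult.assoc[symmetric])
  qed simp
  have "f (a, b) = 0" using \<open>t0 > 0\<close> by (simp add: f_def \<eta>_def \<theta>_def)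
  have "norm (\<eta> P) < 2 * t0"
  proof (rule ccontr)
    assume "\<not> ?thesis"
    then have "t0\<^sup>2 \<le> (max 0 (norm (\<eta> P) - t0))\<^sup>2" using \<open>t0 > 0\<close> by (intro power_mono) auto
    then have "M * t0\<^sup>2 \<le> M * (max 0 (norm (\<eta> P) - t0))\<^sup>2" using \<open>0 \<le> M\<close> by (rule mult_left_mono)
    then have "norm p * R + 2 \<le> \<theta> (norm (\<eta> P))"
      using \<open>t0 > 0\<close> \<open>0 < L\<close> by (simp add: M_def \<theta>_def add_increasing)
    then have "2 \<le> f P" using lower[OF P] by (simp add: f_def)
    then show False using P_le[OF ab_in] \<open>f (a, b) = 0\<close> \<epsilon> by simp
  qed
  with strong have "(s - r) * norm (u - a) < (s - r) * R" by (simp add: t0_def)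
  then have interior: "norm (u - a) < R" using \<open>r < s\<close> by simp
  show False
  proof (cases "\<eta> P = 0")
    \<comment> \<open>Here \<open>u = a\<close> and the function is 0 at \<open>P\<close>, although
      it lies below \<open>- \<epsilon>\<close> at \<open>(x, y)\<close>.\<close>
    case True
    with strong have "u = a" using \<open>r < s\<close> by (simp add: mult_le_0_iff)
    then have "f P = 0" using True \<open>t0 > 0\<close> by (simp add: f_def \<theta>_def Puv)
    moreover have "f (x, y) = L * N - (norm p)\<^sup>2"
      using near by (simp add: f_def \<theta>_def \<eta>_def N_def t0_def p_def power2_norm_eq_inner algebra_simps)
    ultimately show False using P_le[OF xy_in] \<epsilon> by simp
  next
    case False
    obtain d K where d: "L \<le> norm d" and "0 \<le> K"
      and \<theta>_upper: "\<And>k. \<theta> (norm k) \<le> \<theta> (norm (\<eta> P)) + inner d (k - \<eta> P) + K * (norm (k - \<eta> P))\<^sup>2"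
      using penalty_upper_estimate[OF False \<open>0 < L\<close> \<open>0 \<le> M\<close> \<theta>_def] by blast
    \<comment> \<open>The chain rule through the affine \<open>\<eta>\<close> gives the gradient
      \<open>(p + s *\<^sub>R d, d)\<close>; up to the perturbation \<open>q\<close> the inner
      product is at least \<open>norm d * (s * norm d - norm p)\<close>, which is positive.\<close>
    have "inner ((p + s *\<^sub>R d) + q1) (d + q2) \<le> 0"
    proof (rule approx_minimizer_gradient[where T = T and u = u and v = v and \<epsilon> = \<epsilon> and f = f
          and \<delta> = "R - norm (u - a)" and K = "K * (1 + s)\<^sup>2"])
      show "0 < R - norm (u - a)" using interior by simp
      fix e assume "e \<in> gph T" and e: "norm (e - (u, v)) < R - norm (u - a)"
      have "norm (fst e - u) \<le> norm (e - (u, v))" using norm_fst_le[of "fst e - u" "snd e - v"] by (cases e) simp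
      then have "norm (fst e - a) \<le> R"
        using e norm_triangle_ineq[of "fst e - u" "u - a"] by simp
      then have "e \<in> \<Omega>" using \<open>e \<in> gph T\<close> by (simp add: \<Omega>_def)
      from P_min[OF this]
      show "f (u, v) \<le> f e + inner (q1, q2) (e - (u, v)) + \<epsilon> * (norm (e - (u, v)))\<^sup>2"
        by (simp add: Puv qq)
    next
      fix e :: "'a \<times> 'a"
      obtain e1 e2 where e: "e = (e1, e2)" by (cases e)
      have diff: "\<eta> e - \<eta> P = (e2 - v) + s *\<^sub>R (e1 - u)" by (simp add: \<eta>_def e Puv algebra_simps)
      have "norm (\<eta> e - \<eta> P) \<le> (1 + s) * norm (e - (u, v))"
        unfolding diff using norm_add_scaleR_le_Pair[of s "e2 - v" "e1 - u"] \<open>0 < s\<close> by (simp add: e)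
      then have "(norm (\<eta> e - \<eta> P))\<^sup>2 \<le> ((1 + s) * norm (e - (u, v)))\<^sup>2" by (intro power_mono) auto
      then have "K * (norm (\<eta> e - \<eta> P))\<^sup>2 \<le> K * ((1 + s) * norm (e - (u, v)))\<^sup>2"
        using \<open>0 \<le> K\<close> by (rule mult_left_mono)
      then have "f e \<le> inner p (e1 - a) + \<theta> (norm (\<eta> P)) + inner d (\<eta> e - \<eta> P)
          + K * ((1 + s) * norm (e - (u, v)))\<^sup>2"
        using \<theta>_upper[of "\<eta> e"] by (simp add: f_def e)
      then show "f e \<le> f (u, v) + inner (p + s *\<^sub>R d, d) (e - (u, v))
          + K * (1 + s)\<^sup>2 * (norm (e - (u, v)))\<^sup>2"
        unfolding diff power_mult_distrib by (simp add: f_def Puv e algebra_simps)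
    qed (rule pos[OF uv(1)])
    then have "s * (norm d)\<^sup>2 + inner p d + inner q1 d + s * inner d q2 + inner p q2 + inner q1 q2 \<le> 0"
      by (simp add: inner_add_left inner_add_right power2_norm_eq_inner)
    moreover
    have q_le: "norm q1 \<le> \<epsilon>" "norm q2 \<le> \<epsilon>"
      using q norm_fst_le[of q1 q2] norm_snd_le[of q2 q1] by (simp_all add: qq)
    have CS: "- (A * B) \<le> inner g h" if "norm g \<le> A" "norm h \<le> B" for g h :: 'a and A B
    proof -
      have "norm g * norm h \<le> A * B" using that by (intro mult_mono) (auto intro: order_trans[OF norm_ge_zero])
      then show ?thesis using Cauchy_Schwarz_ineq2[of g h] by linarith
    qed
    have "s * - (norm d * \<epsilon>) \<le> s * inner d q2"
      using \<open>0 < s\<close> by (intro mult_left_mono CS q_le) auto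
    ultimately have "s * (norm d)\<^sup>2 - norm p * norm d - \<epsilon> * norm d + s * - (norm d * \<epsilon>)
        - norm p * \<epsilon> - \<epsilon> * \<epsilon> \<le> 0"
      using CS[OF q_le(1) order_refl, of d] CS[OF order_refl q_le(2), of p] CS[OF q_le]
        CS[OF order_refl order_refl, of p d] by linarith
    then have *: "norm d * (s * norm d - norm p - \<epsilon> * (1 + s)) \<le> \<epsilon> * (norm p + \<epsilon>)"
      by (simp add: algebra_simps power2_eq_square)
    have "\<epsilon> * ((1 + s) * L) < X * L"
    proof -
      have "\<epsilon> * ((1 + s) * L) \<le> \<epsilon> * Y" using \<epsilon>(1) by (intro mult_left_mono) (auto simp: Y_def)
      then show ?thesis using \<epsilon>(4) by simp
    qed
    then have "\<epsilon> * (1 + s) < X" using \<open>0 < L\<close> by (simp add: mult.assoc[symmetric])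
    moreover have "s * L \<le> s * norm d" using d \<open>0 < s\<close> by simp
    ultimately have "L * (X - \<epsilon> * (1 + s)) \<le> norm d * (s * norm d - norm p - \<epsilon> * (1 + s))"
      using d \<open>0 < L\<close> by (intro mult_mono) (auto simp: X_def)
    also have "\<dots> \<le> \<epsilon> * (norm p + 1)"
      using * mult_left_mono[of "norm p + \<epsilon>" "norm p + 1" \<epsilon>] \<epsilon> by linarith
    finally have "X * L \<le> \<epsilon> * Y" by (simp add: Y_def algebra_simps)
    then show False using \<epsilon>(4) by simp
  qed
qed

text \<open>Squaring the expansive estimate cancels the terms quadratic in \<open>s\<close> and
  bounds \<open>2 * s * inner (y - b) (x - a)\<close> below independently of \<open>s\<close>; a
  large \<open>s\<close> excludes a negative inner product.\<close>

lemma coderivative_locally_monotone: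
  fixes T :: "'a::{real_inner, complete_space} \<Rightarrow> 'a set"
  assumes "closed (gph T)"
    and pos: "\<And>u v w z. (u, v) \<in> gph T \<Longrightarrow> z \<in> regular_coderivative T u v w \<Longrightarrow> 0 \<le> inner z w"
    and ab: "(a, b) \<in> gph T" and "R > 0" "r > 0"
    and hypo: "\<And>u v. (u, v) \<in> gph T \<Longrightarrow> norm (u - a) \<le> R \<Longrightarrow>
      - r * (norm (u - a))\<^sup>2 \<le> inner (v - b) (u - a)"
    and xy: "(x, y) \<in> gph T" and "norm (x - a) < R / 2"
  shows "0 \<le> inner (y - b) (x - a)"
proof (rule ccontr)
  assume "\<not> ?thesis"
  then have "inner (y - b) (x - a) < 0" by simp
  define \<mu> where "\<mu> = - inner (y - b) (x - a)"
  have "\<mu> > 0" using \<open>inner (y - b) (x - a) < 0\<close> by (simp add: \<mu>_def)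
  define g where "g = R / 2 - norm (x - a)"
  have "g > 0" using assms(8) by (simp add: g_def)
  \<comment> \<open>The three entries secure \<open>r < s\<close>, the hypothesis
    \<open>near\<close> (attainable because \<open>norm (x - a) < R / 2\<close>), and the final
    contradiction.\<close>
  define s where "s = max (r + 1) (max ((r * R / 2 + norm (y - b)) / g) ((norm (y - b))\<^sup>2 / \<mu> + 1))"
  have "r < s" by (simp add: s_def less_max_iff_disj)
  have "(r * R / 2 + norm (y - b)) / g \<le> s" by (simp add: s_def)
  then have "r * R / 2 + norm (y - b) \<le> s * g" using \<open>g > 0\<close> by (simp add: field_simps)
  then have "norm (y - b) + s * norm (x - a) \<le> (s - r) * R / 2" by (simp add: g_def algebra_simps)
  moreover have "norm ((y - b) + s *\<^sub>R (x - a)) \<le> norm (y - b) + s * norm (x - a)"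
    using norm_triangle_ineq[of "y - b" "s *\<^sub>R (x - a)"] \<open>r > 0\<close> \<open>r < s\<close> by simp
  ultimately have near: "norm ((y - b) + s *\<^sub>R (x - a)) \<le> (s - r) * R / 2" by linarith
  have "s * norm (x - a) \<le> norm ((y - b) + s *\<^sub>R (x - a))"
    by (rule coderivative_expansive[OF assms(1) pos ab \<open>R > 0\<close> \<open>r > 0\<close> hypo \<open>r < s\<close> xy _ near])
      (use assms(4,8) in simp_all)
  then have "(s * norm (x - a))\<^sup>2 \<le> (norm ((y - b) + s *\<^sub>R (x - a)))\<^sup>2"
    using \<open>r > 0\<close> \<open>r < s\<close> by (intro power_mono) auto
  then have "2 * (s * \<mu>) \<le> (norm (y - b))\<^sup>2"
    by (simp add: power_mult_distrib power2_norm_eq_inner inner_add_left inner_add_right \<mu>_def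
        inner_commute power2_eq_square[of s])
  moreover have "(norm (y - b))\<^sup>2 / \<mu> + 1 \<le> s" by (simp add: s_def)
  then have "(norm (y - b))\<^sup>2 + \<mu> \<le> s * \<mu>" using \<open>\<mu> > 0\<close> by (simp add: field_simps)
  ultimately show False using \<open>\<mu> > 0\<close> by (smt (verit) zero_le_power2)
qed

section \<open>Surjectivity of the identity plus \<open>T\<close>, and maximality\<close>

text \<open>Half the squared residual has gradient \<open>(d, d)\<close>, so positivity forces
  \<open>inner d d \<le> 0\<close> up to the perturbation. Monotonicity makes the resulting
  approximate solutions converge, and closedness keeps the limit in the graph.\<close>

lemma coderivative_monotone_range:
  fixes T :: "'a::{real_inner, complete_space} \<Rightarrow> 'a set"
  assumes "closed (gph T)" "gph T \<noteq> {}" and "monotone_sv T"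
    and pos: "\<And>u v w z. (u, v) \<in> gph T \<Longrightarrow> z \<in> regular_coderivative T u v w \<Longrightarrow> 0 \<le> inner z w"
  obtains u v where "(u, v) \<in> gph T" "u + v = y"
proof -
  define f where "f = (\<lambda>e::'a\<times>'a. (norm (fst e + snd e - y))\<^sup>2 / 2)"
  have approx: "\<exists>u v. (u, v) \<in> gph T \<and> norm (u + v - y) \<le> 3 * \<epsilon>" if eps: "0 < \<epsilon>" for \<epsilon>
  proof -
    have "continuous_on (gph T) f" unfolding f_def by (intro continuous_intros) auto
    moreover have "0 \<le> f e" if "e \<in> gph T" for e by (simp add: f_def)
    ultimately obtain P q where "P \<in> gph T" and q: "norm q \<le> \<epsilon>"
      and P_min: "\<And>e. e \<in> gph T \<Longrightarrow> f P \<le> f e + inner q (e - P) + \<epsilon> * (norm (e - P))\<^sup>2"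
      using smooth_variational_principle[OF assms(1,2) _ _ eps] by blast
    obtain u v where Puv: "P = (u, v)" by (cases P)
    obtain q1 q2 where qq: "q = (q1, q2)" by (cases q)
    define d where "d = u + v - y"
    have uv: "(u, v) \<in> gph T" using \<open>P \<in> gph T\<close> Puv by simp
    have "inner (d + q1) (d + q2) \<le> 0"
    proof (rule approx_minimizer_gradient[where T = T and u = u and v = v and \<epsilon> = \<epsilon> and f = f
          and \<delta> = 1 and K = 2])
      fix e assume "e \<in> gph T"
      from P_min[OF this]
      show "f (u, v) \<le> f e + inner (q1, q2) (e - (u, v)) + \<epsilon> * (norm (e - (u, v)))\<^sup>2"
        by (simp add: Puv qq)
    next
      fix e :: "'a \<times> 'a"
      obtain e1 e2 where e: "e = (e1, e2)" by (cases e)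
      define k where "k = (e2 - v) + (e1 - u)"
      have "norm k \<le> 2 * norm (e - (u, v))"
        using norm_add_scaleR_le_Pair[of 1 "e2 - v" "e1 - u"] by (simp add: e k_def)
      then have "(norm k)\<^sup>2 \<le> (2 * norm (e - (u, v)))\<^sup>2" by (intro power_mono) auto
      moreover have "f e = f (u, v) + inner d k + (norm k)\<^sup>2 / 2"
      proof -
        have "e1 + e2 - y = d + k" by (simp add: d_def k_def)
        then show ?thesis
          by (simp add: f_def e flip: d_def)
            (simp add: power2_norm_eq_inner inner_add_left inner_add_right inner_commute add_divide_distrib)
      qed
      moreover have "inner d k = inner (d, d) (e - (u, v))"
        by (simp add: k_def e inner_add_right)
      ultimately show "f e \<le> f (u, v) + inner (d, d) (e - (u, v)) + 2 * (norm (e - (u, v)))\<^sup>2"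
        by (simp add: power_mult_distrib)
    qed (use pos[OF uv] in auto)
    then have "(norm d)\<^sup>2 + inner d q2 + inner q1 d + inner q1 q2 \<le> 0"
      by (simp add: inner_add_left inner_add_right power2_norm_eq_inner)
    moreover have n: "norm q1 \<le> \<epsilon>" "norm q2 \<le> \<epsilon>"
      using q norm_fst_le[of q1 q2] norm_snd_le[of q2 q1] by (simp_all add: qq)
    moreover have "- (norm d * \<epsilon>) \<le> inner d q2" "- (\<epsilon> * norm d) \<le> inner q1 d" "- (\<epsilon> * \<epsilon>) \<le> inner q1 q2"
      using Cauchy_Schwarz_ineq2[of d q2] Cauchy_Schwarz_ineq2[of q1 d] Cauchy_Schwarz_ineq2[of q1 q2]
        mult_left_mono[OF n(2) norm_ge_zero[of d]] mult_right_mono[OF n(1) norm_ge_zero[of d]]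
        mult_mono[OF n] \<open>0 < \<epsilon>\<close> by auto
    \<comment> \<open>The perturbed form of \<open>inner d d \<le> 0\<close>; it fails as soon as
      \<open>norm d\<close> exceeds \<open>3 * \<epsilon>\<close>.\<close>
    ultimately have *: "norm d * (norm d - 2 * \<epsilon>) \<le> \<epsilon> * \<epsilon>"
      by (simp add: algebra_simps power2_eq_square)
    have "norm d \<le> 3 * \<epsilon>"
    proof (rule ccontr)
      assume "\<not> ?thesis"
      then have "3 * \<epsilon> * \<epsilon> \<le> norm d * (norm d - 2 * \<epsilon>)" using \<open>0 < \<epsilon>\<close> by (intro mult_mono) auto
      moreover have "0 < \<epsilon> * \<epsilon>" using \<open>0 < \<epsilon>\<close> by simp
      ultimately show False using * by linarith
    qed
    with uv show ?thesis unfolding d_def by blast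
  qed
  have "\<forall>n. \<exists>u v. (u, v) \<in> gph T \<and> norm (u + v - y) \<le> 3 * inverse (real (Suc n))"
    by (intro allI approx) simp
  then obtain u v where uv: "\<And>n. (u n, v n) \<in> gph T"
    and le: "\<And>n. norm (u n + v n - y) \<le> 3 * inverse (real (Suc n))" by metis
  have "(\<lambda>n. norm (u n + v n - y)) \<longlonglongrightarrow> 0"
  proof (rule tendsto_sandwich[of "\<lambda>_. 0"])
    show "(\<lambda>n. 3 * inverse (real (Suc n))) \<longlonglongrightarrow> 0"
      using tendsto_mult_right_zero[OF LIMSEQ_inverse_real_of_nat] by simp
    show "\<forall>\<^sub>F n in sequentially. norm (u n + v n - y) \<le> 3 * inverse (real (Suc n))"
      by (intro always_eventually allI le)
  qed auto
  then have lim: "(\<lambda>n. u n + v n) \<longlonglongrightarrow> y" by (simp add: tendsto_norm_zero_iff LIM_zero_iff)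
  \<comment> \<open>Under monotonicity \<open>u\<close> depends nonexpansively on the sum, so
    convergent sums make \<open>u\<close> Cauchy.\<close>
  have contr: "norm (u n - u k) \<le> norm ((u n + v n) - (u k + v k))" for n k
  proof (cases "u n = u k")
    case False
    have "0 \<le> inner (v n - v k) (u n - u k)"
      using \<open>monotone_sv T\<close> uv unfolding monotone_sv_def by blast
    then have "(norm (u n - u k))\<^sup>2 \<le> inner ((u n + v n) - (u k + v k)) (u n - u k)"
      by (simp add: power2_norm_eq_inner algebra_simps)
    also have "\<dots> \<le> norm ((u n + v n) - (u k + v k)) * norm (u n - u k)" by (rule norm_cauchy_schwarz)
    finally show ?thesis using False by (simp add: power2_eq_square)
  qed simp
  have "Cauchy (\<lambda>n. u n + v n)" using lim convergent_Cauchy convergentI by blast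
  then have "Cauchy u"
    unfolding Cauchy_def dist_norm using contr by (meson le_less_trans)
  then obtain l where l: "u \<longlonglongrightarrow> l" using Cauchy_convergent convergent_def by blast
  have "(\<lambda>n. (u n + v n) - u n) \<longlonglongrightarrow> y - l" by (intro tendsto_diff lim l)
  then have "v \<longlonglongrightarrow> y - l" by simp
  with l have "(\<lambda>n. (u n, v n)) \<longlonglongrightarrow> (l, y - l)" by (rule tendsto_Pair)
  then have "(l, y - l) \<in> gph T"
    using closed_sequentially[OF assms(1), of "\<lambda>n. (u n, v n)" "(l, y - l)"] uv by simp
  then show thesis by (rule that) simp
qed

text \<open>A point of an extension and the graph point with the same sum have opposite differences,
  so monotonicity of the extension identifies them.\<close>

lemma monotone_range_imp_maximal:
  fixes T :: "'a::real_inner \<Rightarrow> 'a set"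
  assumes "monotone_sv T" and "\<And>y. \<exists>u v. (u, v) \<in> gph T \<and> u + v = y"
  shows "maximal_monotone_sv T"
  unfolding maximal_monotone_sv_def
proof (intro conjI allI impI)
  fix S :: "'a \<Rightarrow> 'a set" assume S: "monotone_sv S" "gph T \<subseteq> gph S"
  have "(x, y) \<in> gph T" if "(x, y) \<in> gph S" for x y
  proof -
    obtain u v where uv: "(u, v) \<in> gph T" "u + v = x + y" using assms(2) by blast
    then have "y - v = - (x - u)" by (simp add: algebra_simps)
    moreover have "0 \<le> inner (y - v) (x - u)"
      using S that uv unfolding monotone_sv_def by blast
    ultimately have "inner (x - u) (x - u) \<le> 0" by (metis inner_minus_left neg_0_le_iff_le)
    then have "x = u" by (metis antisym inner_eq_zero_iff inner_ge_zero right_minus_eq)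
    then show ?thesis using uv by simp
  qed
  with S(2) show "gph S = gph T" by auto
qed (rule assms)

lemma regular_coderivative_subset_mixed:
  assumes "(u, v) \<in> gph T"
  shows "regular_coderivative T u v w \<subseteq> mixed_coderivative T u v w"
proof
  fix z assume "z \<in> regular_coderivative T u v w"
  with assms show "z \<in> mixed_coderivative T u v w"
    unfolding mixed_coderivative_def weakly_converges_def
    by (intro CollectI exI[of _ "\<lambda>_. u"] exI[of _ "\<lambda>_. v"] exI[of _ "\<lambda>_. w"] exI[of _ "\<lambda>_. z"]) auto
qed

lemma coderivative_positive_regularD:
  assumes "coderivative_positive T" "(u, v) \<in> gph T" "z \<in> regular_coderivative T u v w"
  shows "0 \<le> inner z w"
  using assms regular_coderivative_subset_mixed unfolding coderivative_positive_def by blast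

section \<open>From local to global monotonicity on a convex domain\<close>

text \<open>Along a segment, inequalities over adjacent intervals add up, because convexity provides
  a value of \<open>T\<close> at each intermediate point; bisection globalizes them.\<close>

lemma monotone_sv_if_locally_monotone:
  fixes T :: "'a::real_inner \<Rightarrow> 'a set"
  assumes "convex (dom_sv T)"
    and loc: "\<And>c. c \<in> dom_sv T \<Longrightarrow> \<exists>\<rho>>0. \<forall>u1 v1 u2 v2. (u1, v1) \<in> gph T \<longrightarrow> (u2, v2) \<in> gph T \<longrightarrow>
      dist c u1 < \<rho> \<longrightarrow> dist c u2 < \<rho> \<longrightarrow> 0 \<le> inner (v1 - v2) (u1 - u2)"
  shows "monotone_sv T"
  unfolding monotone_sv_def
proof (intro allI impI)
  fix x1 y1 x2 y2 assume xy: "(x1, y1) \<in> gph T" "(x2, y2) \<in> gph T"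
  define h where "h = x1 - x2"
  define \<gamma> where "\<gamma> = (\<lambda>t::real. x2 + t *\<^sub>R h)"
  have dom: "\<gamma> t \<in> dom_sv T" if "0 \<le> t" "t \<le> 1" for t
  proof -
    have "\<gamma> t = (1 - t) *\<^sub>R x2 + t *\<^sub>R x1" by (simp add: \<gamma>_def h_def algebra_simps)
    moreover have "x1 \<in> dom_sv T" "x2 \<in> dom_sv T" using xy by (auto simp: gph_def dom_sv_def)
    ultimately show ?thesis using convexD_alt[OF assms(1)] that by simp
  qed
  \<comment> \<open>Testing against the fixed \<open>h\<close>, rather than
    \<open>\<gamma> t - \<gamma> s\<close>, is what makes the inequalities additive. The guards
    discard degenerate intervals and those leaving the unit interval.\<close>
  define Q where "Q = (\<lambda>s t. 0 \<le> s \<longrightarrow> t \<le> 1 \<longrightarrow> s < t \<longrightarrow>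
      (\<forall>v\<in>T (\<gamma> s). \<forall>w\<in>T (\<gamma> t). 0 \<le> inner (w - v) h))"
  have "(0::real) \<le> 1" by simp
  then have "Q 0 1"
  proof (induction rule: Bolzano)
    case (trans a b c)
    show ?case
      unfolding Q_def
    proof (intro impI ballI)
      fix v w assume *: "0 \<le> a" "c \<le> 1" "a < c" "v \<in> T (\<gamma> a)" "w \<in> T (\<gamma> c)"
      show "0 \<le> inner (w - v) h"
      proof (cases "b = a \<or> b = c")
        case True
        then show ?thesis using trans * unfolding Q_def by blast
      next
        case False
        obtain x where "x \<in> T (\<gamma> b)" using dom[of b] * trans(3,4) by (auto simp: dom_sv_def)
        then have "0 \<le> inner (w - x) h" "0 \<le> inner (x - v) h"
          using trans * False unfolding Q_def by auto
        then show ?thesis by (simp add: inner_diff_left)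
      qed
    qed
  next
    case (local t)
    then obtain \<rho> where "\<rho> > 0" and \<rho>: "\<And>u1 v1 u2 v2. (u1, v1) \<in> gph T \<Longrightarrow> (u2, v2) \<in> gph T \<Longrightarrow>
        dist (\<gamma> t) u1 < \<rho> \<Longrightarrow> dist (\<gamma> t) u2 < \<rho> \<Longrightarrow> 0 \<le> inner (v1 - v2) (u1 - u2)"
      using loc[OF dom[of t]] by auto
    define \<delta> where "\<delta> = \<rho> / (norm h + 1)"
    have "\<delta> > 0" using \<open>\<rho> > 0\<close> by (simp add: \<delta>_def add_nonneg_pos)
    have near: "dist (\<gamma> t) (\<gamma> s) < \<rho>" if "\<bar>t - s\<bar> < \<delta>" for s
    proof -
      have "dist (\<gamma> t) (\<gamma> s) = \<bar>t - s\<bar> * norm h"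
        by (simp add: \<gamma>_def dist_norm flip: scaleR_diff_left)
      also have "\<dots> \<le> \<bar>t - s\<bar> * (norm h + 1)" by (intro mult_left_mono) auto
      also have "\<dots> < \<rho>" using that by (simp add: \<delta>_def pos_less_divide_eq add_nonneg_pos)
      finally show ?thesis .
    qed
    show ?case
    proof (intro exI[of _ \<delta>] conjI allI impI \<open>\<delta> > 0\<close>)
      fix a b assume ab: "a \<le> t \<and> t \<le> b \<and> b - a < \<delta>"
      show "Q a b"
        unfolding Q_def
      proof (intro impI ballI)
        fix v w assume *: "a < b" "v \<in> T (\<gamma> a)" "w \<in> T (\<gamma> b)"
        have "0 \<le> inner (w - v) (\<gamma> b - \<gamma> a)"
          using * ab near by (intro \<rho>) (auto simp: gph_def)
        also have "\<gamma> b - \<gamma> a = (b - a) *\<^sub>R h" by (simp add: \<gamma>_def algebra_simps)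
        finally show "0 \<le> inner (w - v) h" using \<open>a < b\<close> by (simp add: zero_le_mult_iff)
      qed
    qed
  qed
  then show "0 \<le> inner (y1 - y2) (x1 - x2)"
    using xy by (auto simp: Q_def \<gamma>_def h_def gph_def)
qed

section \<open>Assembling the two equivalences\<close>

theorem theorem3p7:
  fixes T :: "'a::{real_inner, complete_space} \<Rightarrow> 'a set"
  assumes "proper_sv T"
    and "closed (gph T)"
  shows "(maximal_monotone_sv T \<longleftrightarrow> hypomonotone_sv T \<and> coderivative_positive T)
       \<and> (convex (dom_sv T) \<longrightarrow>
           (maximal_monotone_sv T \<longleftrightarrow> semilocally_hypomonotone_sv T \<and> coderivative_positive T))"
proof -
  have ne: "gph T \<noteq> {}" using assms(1) by (auto simp: proper_sv_def dom_sv_def gph_def)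
  have fwd: "hypomonotone_sv T \<and> semilocally_hypomonotone_sv T \<and> coderivative_positive T"
    if max: "maximal_monotone_sv T"
  proof -
    have mono: "- 1 * (norm (u1 - u2))\<^sup>2 \<le> inner (v1 - v2) (u1 - u2)"
      if "(u1, v1) \<in> gph T" "(u2, v2) \<in> gph T" for u1 v1 u2 v2
    proof -
      have "0 \<le> inner (v1 - v2) (u1 - u2)"
        using max that unfolding maximal_monotone_sv_def monotone_sv_def by blast
      then show ?thesis using zero_le_power2[of "norm (u1 - u2)"] by linarith
    qed
    have "hypomonotone_sv T"
      unfolding hypomonotone_sv_def by (rule exI[of _ 1]) (use mono in simp)
    moreover have "semilocally_hypomonotone_sv T"
      unfolding semilocally_hypomonotone_sv_def
      by (intro ballI exI[of _ UNIV] exI[of _ 1]) (use mono in simp)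
    ultimately show ?thesis using maximal_monotone_imp_coderivative_positive[OF max] by blast
  qed
  have max: "maximal_monotone_sv T" if "monotone_sv T" "coderivative_positive T"
  proof (rule monotone_range_imp_maximal[OF that(1)])
    fix y show "\<exists>u v. (u, v) \<in> gph T \<and> u + v = y"
      using coderivative_monotone_range[OF assms(2) ne that(1), of y]
        coderivative_positive_regularD[OF that(2)] by blast
  qed
  note mono_near = coderivative_locally_monotone[OF assms(2) coderivative_positive_regularD]
  have hypo: "monotone_sv T" if h: "hypomonotone_sv T" and c: "coderivative_positive T"
    unfolding monotone_sv_def
  proof (intro allI impI)
    fix x y a b assume xy: "(x, y) \<in> gph T" and ab: "(a, b) \<in> gph T"
    obtain r where "r > 0" and r: "\<And>u1 v1 u2 v2. (u1, v1) \<in> gph T \<Longrightarrow> (u2, v2) \<in> gph T \<Longrightarrow>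
        - r * (norm (u1 - u2))\<^sup>2 \<le> inner (v1 - v2) (u1 - u2)"
      using h unfolding hypomonotone_sv_def by blast
    show "0 \<le> inner (y - b) (x - a)"
      \<comment> \<open>Global hypomonotonicity permits every radius; this one puts \<open>x\<close>
        within \<open>R / 2\<close> of \<open>a\<close>.\<close>
      by (rule mono_near[OF c _ _ ab _ \<open>r > 0\<close> r[OF _ ab] xy, where R = "2 * norm (x - a) + 2"])
        (auto simp: add_nonneg_pos)
  qed
  have semi: "monotone_sv T"
    if h: "semilocally_hypomonotone_sv T" and d: "coderivative_positive T" and "convex (dom_sv T)"
  proof (rule monotone_sv_if_locally_monotone[OF that(3)])
    fix c assume "c \<in> dom_sv T"
    then obtain U r where U: "open U" "c \<in> U" "r > 0" and r: "\<And>u1 v1 u2 v2. (u1, v1) \<in> gph T \<Longrightarrow>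
        (u2, v2) \<in> gph T \<Longrightarrow> u1 \<in> U \<Longrightarrow> u2 \<in> U \<Longrightarrow> - r * (norm (u1 - u2))\<^sup>2 \<le> inner (v1 - v2) (u1 - u2)"
      using h unfolding semilocally_hypomonotone_sv_def by meson
    obtain e where "e > 0" "ball c e \<subseteq> U" using openE[OF U(1,2)] by blast
    show "\<exists>\<rho>>0. \<forall>u1 v1 u2 v2. (u1, v1) \<in> gph T \<longrightarrow> (u2, v2) \<in> gph T \<longrightarrow>
      dist c u1 < \<rho> \<longrightarrow> dist c u2 < \<rho> \<longrightarrow> 0 \<le> inner (v1 - v2) (u1 - u2)"
    \<comment> \<open>Two points within \<open>e / 8\<close> of \<open>c\<close> are less than
      \<open>e / 4\<close> apart, and the ball of radius \<open>e / 2\<close> about either stays in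
      \<open>U\<close>.\<close>
    proof (intro exI[of _ "e / 8"] conjI allI impI)
      fix x y a b
      assume xy: "(x, y) \<in> gph T" and ab: "(a, b) \<in> gph T" and x: "dist c x < e / 8" and a: "dist c a < e / 8"
      show "0 \<le> inner (y - b) (x - a)"
      proof (rule mono_near[OF d _ _ ab _ \<open>r > 0\<close> _ xy, where R = "e / 2"])
        fix u v assume uv: "(u, v) \<in> gph T" "norm (u - a) \<le> e / 2"
        have "dist c u \<le> dist c a + dist u a" by (rule dist_triangle2)
        then have "u \<in> U" "a \<in> U" using \<open>ball c e \<subseteq> U\<close> uv(2) a \<open>e > 0\<close> by (auto simp: dist_norm)
        then show "- r * (norm (u - a))\<^sup>2 \<le> inner (v - b) (u - a)" using r[OF uv(1) ab] by blast
      next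
        have "dist x a \<le> dist c x + dist c a" by (rule dist_triangle3)
        then show "norm (x - a) < e / 2 / 2" using x a by (simp add: dist_norm)
      qed (use \<open>e > 0\<close> in auto)
    qed (use \<open>e > 0\<close> in simp)
  qed
  show ?thesis using fwd max hypo semi by blast
qed

end
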